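(* Consider a $4$-dimensional toric generalized K\"ahler structure $(G,\mathcal J)$ on $M$, determined by a matrix valued function $\Psi=\mathrm{Hess}(\tau)+C$ with $C_{12}\neq0$ (see context), such that $\frac{\partial}{\partial\mu^{2}}\left(\frac{(\Psi_{12})^{s}}{\Psi_{22}}\right)$ depends only on $\mu^{1}$. Let $k_{0},\lambda_{0}\in\mathbb{R}\setminus\{0\}$ and $k_{1}\in\mathbb{R}$. Choose $X_{0}:=-\frac{\partial}{\partial t^{1}}$, $$a:=k_{0}k_{1}-\lambda_{0}\mu^{1},\qquad h^{2}:=\frac{-k_{0}}{\lambda_{0}\mu^{1}-k_{0}k_{1}},\qquad f^{2}:=\frac{\left(\mu^{1}-\frac{k_{0}k_{1}}{\lambda_{0}}\right)\frac{\partial}{\partial\mu^{2}}\left(\frac{(\Psi_{12})^{s}}{\Psi_{22}}\right)+1}{\left(\mu^{1}-\frac{k_{0}k_{1}}{\lambda_{0}}\right)\frac{\partial}{\partial\mu^{2}}\left(\frac{(\Psi_{12})^{s}}{\Psi_{22}}\right)-1},$$ and $$F:=\frac{2ah'}{h}d\mu^{1}\wedge dt^{1}+\left(\frac{(\Psi_{12})^{s}}{\Psi_{22}}\Big(\lambda_{0}-\frac{2ah'}{h}\Big)d\mu^{1}+\lambda_{0}\,d\mu^{2}\right)\wedge dt^{2},$$ and assume that the defining expression for $a$ is non-vanishing, while the defining expressions for $h^{2}$ and $f^{2}$ are positive. Then $F$ is closed and $X_{0}$-invariant, $da=-i_{X_{0}}F$, and all the conditions (KK1)--(KK5) stated in the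 context are satisfied.
   Context: Generalized geometry. $\mathbb{T}M=TM\oplus T^{*}M$ with projections $\mathrm{pr}_{T},\mathrm{pr}_{T^{*}}$, and $\langle X+\xi,Y+\eta\rangle=\frac12(\eta(X)+\xi(Y))$; everything is extended complex (bi)linearly to $(\mathbb{T}M)^{\mathbb{C}}$. For a pair $(G,\mathcal J)$ of a positive definite metric $G$ on $\mathbb{T}M$ and a $G$-orthogonal, $\langle\cdot,\cdot\rangle$-skew $\mathcal J\in\Gamma\,\mathrm{End}(\mathbb{T}M)$ with $\mathcal J^{2}=-\mathrm{Id}$, $G^{\mathrm{end}}$ is defined by $G(u,v)=\langle G^{\mathrm{end}}u,v\rangle$ (with $(G^{\mathrm{end}})^{2}=\mathrm{Id}$); $\mathcal J_{1}=\mathcal J$, $\mathcal J_{2}=G^{\mathrm{end}}\mathcal J$, $\mathcal J_{3}=\mathcal J_{1}\mathcal J_{2}=-G^{\mathrm{end}}$. $L_{i}$ is the $i$-eigenbundle ($(1,0)$-bundle) of $\mathcal J_{i}$ in $(\mathbb{T}M)^{\mathbb{C}}$ ($i=1,2$), $E_{i}=\mathrm{pr}_{T}(L_{i})$ and $\epsilon_{i}\in\Gamma(\Lambda^{2}E_{i}^{*})$ is determined by $L_{i}=\{X+\xi\in E_{i}\oplus(T^{*}M)^{\mathbb{C}}:\xi|_{E_{i}}=i_{X}\epsilon_{i}\}$. Toric (diagonal) generalized K\"ahler structures in dimension four. $M$ is a connected $4$-manifold with coordinates $(t^{1},t^{2},\mu^{1},\mu^{2})$; $\tau(\mu^{1},\mu^{2})$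 is smooth with positive definite Hessian, $C$ is a constant real skew-symmetric $2\times2$ matrix and $\Psi_{ij}=\frac{\partial^{2}\tau}{\partial\mu^{i}\partial\mu^{j}}+C_{ij}$, with inverse $(\Psi^{ij})$. $(\Psi_{12})^{s}=\frac12(\Psi_{12}+\Psi_{21})$ is the symmetric part. A prime denotes $d/d\mu^{1}$. Put $\omega=\sum_{i}d\mu^{i}\wedge dt^{i}$, $$J_{+}=\sum_{i,j}\Psi_{ij}\frac{\partial}{\partial t^{i}}\otimes d\mu^{j}-\sum_{i,j}\Psi^{ij}\frac{\partial}{\partial\mu^{i}}\otimes dt^{j},\qquad J_{-}=\sum_{i,j}\Psi_{ji}\frac{\partial}{\partial t^{i}}\otimes d\mu^{j}-\sum_{i,j}\Psi^{ji}\frac{\partial}{\partial\mu^{i}}\otimes dt^{j},$$ and, with $\omega:TM\to T^{*}M$, $X\mapsto i_{X}\omega$, $g=-\frac12\omega\circ(J_{+}+J_{-})$ (a Riemannian metric), $b=-\frac12\omega\circ(J_{+}-J_{-})$ (a $2$-form), viewed as maps $TM\to T^{*}M$. The structure $(G,\mathcal J)$ is: $G^{\mathrm{end}}=\pm\mathrm{Id}$ on $C_{\pm}=\{X+(b\pm g)(X)\}$ and $\mathcal J(X+(b\pm g)X)=J_{\pm}X+(b\pm g)J_{\pm}X$. It is generalized K\"ahler with $\mathcal J_{2}(X+\xi)=-\omega^{-1}(\xi)+i_{X}\omega$; $X_{0}=-\partial/\partial t^{1}$ satisfies $\mathcal L_{X_{0}}\mathcal J=0$, $\mathcal L_{X_{0}}G=0$,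 $\mathcal J_{2}X_{0}=d\mu^{1}$. $X_{0}$-invariant means invariant under the flow of $X_{0}$. Auxiliary objects. $\mathcal S=\mathrm{span}\{X_{0},\mathcal J_{1}X_{0},\mathcal J_{2}X_{0},\mathcal J_{3}X_{0}\}$, $\mathcal S^{\perp}$ its orthogonal complement (the same for $G$ and $\langle\cdot,\cdot\rangle$), subscript $\mathbb{C}$ = complexification, and $$v_{f}:=X_{0}-i\mathcal JX_{0}-\tfrac{1}{f^{2}}(\mathcal J_{3}X_{0}+i\mathcal J_{2}X_{0}),\quad v_{if}:=X_{0}-i\mathcal JX_{0}+\tfrac{1}{f^{2}}(\mathcal J_{3}X_{0}+i\mathcal J_{2}X_{0}),\quad\alpha:=-d\left(\ln\frac{|f^{2}-1|}{f^{2}G(X_{0},X_{0})}\right).$$ Conditions. (KK1) $F$ vanishes on $\Lambda^{2}\mathrm{pr}_{T}(L_{1}\cap L_{2}\cap\mathcal S_{\mathbb{C}}^{\perp})\oplus\Lambda^{2}\mathrm{pr}_{T}(L_{1}\cap\bar L_{2}\cap\mathcal S_{\mathbb{C}}^{\perp})$, and $F(X,Y)X_{0}\in\Gamma(E_{1})$ for all $X\wedge Y\in\Lambda^{2}E_{1}$. (KK2) For $X\in\Gamma\,\mathrm{pr}_{T}(L_{1}\cap L_{2}\cap\mathcal S^{\perp}_{\mathbb{C}})$: $[\mathrm{pr}_{T}(\mathcal J_{3}X_{0}),X]+\alpha(X)\mathrm{pr}_{T}(\mathcal J_{3}X_{0})+\frac{f^{2}F(\mathrm{pr}_{T}(v_{f}),X)}{a(f^{2}-1)}X_{0}\in\Gamma\,\mathrm{pr}_{T}(L_{1}\cap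 L_{2}\cap\mathcal S^{\perp}_{\mathbb{C}})$; for $X\in\Gamma\,\mathrm{pr}_{T}(L_{1}\cap\bar L_{2}\cap\mathcal S^{\perp}_{\mathbb{C}})$: $[\mathrm{pr}_{T}(\mathcal J_{3}X_{0}),X]+\alpha(X)\mathrm{pr}_{T}(\mathcal J_{3}X_{0})-\frac{f^{2}F(\mathrm{pr}_{T}(v_{if}),X)}{a(f^{2}-1)}X_{0}\in\Gamma\,\mathrm{pr}_{T}(L_{1}\cap\bar L_{2}\cap\mathcal S^{\perp}_{\mathbb{C}})$. (KK3) $X(af^{2}h^{2})=0$ for all $X\in\mathrm{pr}_{T}(\mathcal S^{\perp})$. (KK4) $(i_{X_{0}}\epsilon_{1})\wedge F=-\frac{2a}{h}\epsilon_{1}\wedge dh$ on $\Lambda^{3}E_{1}$, and $\epsilon_{2}\wedge dh=0$ on $\mathrm{pr}_{T}(L_{1}\cap L_{2}\cap\mathcal S_{\mathbb{C}}^{\perp})\wedge\mathrm{pr}_{T}(\bar L_{1}\cap L_{2}\cap\mathcal S_{\mathbb{C}}^{\perp})\wedge\mathrm{pr}_{T}(L_{2}\cap\mathcal S_{\mathbb{C}}^{\perp})$. (KK5) On $\Lambda^{2}\mathrm{pr}_{T}(L_{2}\cap\mathcal S_{\mathbb{C}}^{\perp})$: $$d\left(\frac{1-f^{2}}{f^{2}G(X_{0},X_{0})}\mathrm{pr}_{T^{*}}(\mathcal J_{3}X_{0})\right)+\frac{f^{2}-1}{f^{2}G(X_{0},X_{0})}\mathcal D\epsilon_{2}+\frac{2}{af^{2}}F=\frac{2}{hG(X_{0},X_{0})}\left(\mathrm{pr}_{T}(v_{f})(h)\epsilon_{2}+\mathrm{pr}_{T^{*}}(v_{f})\wedge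 dh\right),$$ where, with $Z:=\mathrm{pr}_{T}(\mathcal J_{3}X_{0})$, $(\mathcal D\epsilon_{2})(X,Y)=Z(\epsilon_{2}(X,Y))-\epsilon_{2}([Z,X]+\alpha(X)Z,Y)-\epsilon_{2}(X,[Z,Y]+\alpha(Y)Z)$. *)

theory Defs
  imports "HOL-Analysis.Analysis"
begin

section \<open>Calculus on open subsets of \<open>\<real>\<^sup>n\<close>\<close>

text \<open>A manifold with global coordinates is an open subset of \<open>real ^ 'n\<close>; vector fields and
  one-forms are given by their components in the coordinate (co)frame.\<close>

primrec differentiable_upto ::
  "nat \<Rightarrow> 'a::real_normed_vector set \<Rightarrow> ('a \<Rightarrow> 'b::real_normed_vector) \<Rightarrow> bool" where
  "differentiable_upto 0 U f \<longleftrightarrow> continuous_on U f"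
| "differentiable_upto (Suc k) U f \<longleftrightarrow>
     (\<forall>x\<in>U. f differentiable (at x)) \<and>
     (\<forall>v. differentiable_upto k U (\<lambda>x. frechet_derivative f (at x) v))"

text \<open>The class \<open>C\<^sup>\<infinity>\<close>; meant for open \<open>U\<close> only.\<close>

definition smooth_on :: "'a::real_normed_vector set \<Rightarrow> ('a \<Rightarrow> 'b::real_normed_vector) \<Rightarrow> bool" where
  "smooth_on U f \<longleftrightarrow> (\<forall>k. differentiable_upto k U f)"

definition pd :: "'n \<Rightarrow> (real ^ 'n::finite \<Rightarrow> real) \<Rightarrow> real ^ 'n \<Rightarrow> real" where
  "pd i \<phi> x = frechet_derivative \<phi> (at x) (axis i 1)"

definition diff0 :: "(real ^ 'n::finite \<Rightarrow> real) \<Rightarrow> real ^ 'n \<Rightarrow> real ^ 'n" where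
  "diff0 \<phi> p = (\<chi> i. pd i \<phi> p)"

text \<open>Evaluation of a covector on a vector, and the wedge product of covectors; no factors 1/2.\<close>

definition ev :: "'a::comm_ring_1 ^ 'n::finite \<Rightarrow> 'a ^ 'n \<Rightarrow> 'a" where
  "ev \<xi> X = (\<Sum>i\<in>UNIV. \<xi> $ i * X $ i)"

definition wedge :: "'a::comm_ring_1 ^ 'n::finite \<Rightarrow> 'a ^ 'n \<Rightarrow> 'a ^ 'n \<Rightarrow> 'a ^ 'n \<Rightarrow> 'a" where
  "wedge \<xi> \<eta> X Y = ev \<xi> X * ev \<eta> Y - ev \<xi> Y * ev \<eta> X"

text \<open>Wedge products of a one-form and a two-form, in both orders.\<close>

definition wedge12 :: "('v \<Rightarrow> complex) \<Rightarrow> ('v \<Rightarrow> 'v \<Rightarrow> complex) \<Rightarrow> 'v \<Rightarrow> 'v \<Rightarrow> 'v \<Rightarrow> complex" where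
  "wedge12 \<theta> B X Y Z = \<theta> X * B Y Z + \<theta> Y * B Z X + \<theta> Z * B X Y"

definition wedge21 :: "('v \<Rightarrow> 'v \<Rightarrow> complex) \<Rightarrow> ('v \<Rightarrow> complex) \<Rightarrow> 'v \<Rightarrow> 'v \<Rightarrow> 'v \<Rightarrow> complex" where
  "wedge21 B \<theta> X Y Z = B X Y * \<theta> Z + B Y Z * \<theta> X + B Z X * \<theta> Y"

text \<open>Exterior derivatives, evaluated on constant (hence commuting) vector fields.\<close>

definition extd1 :: "(real ^ 'n::finite \<Rightarrow> real ^ 'n) \<Rightarrow> real ^ 'n \<Rightarrow> real ^ 'n \<Rightarrow> real ^ 'n \<Rightarrow> real" where
  "extd1 \<beta> p u v =
     frechet_derivative (\<lambda>q. ev (\<beta> q) v) (at p) u - frechet_derivative (\<lambda>q. ev (\<beta> q) u) (at p) v"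

definition extd2 :: "(real ^ 'n::finite \<Rightarrow> real ^ 'n \<Rightarrow> real ^ 'n \<Rightarrow> real) \<Rightarrow>
    real ^ 'n \<Rightarrow> real ^ 'n \<Rightarrow> real ^ 'n \<Rightarrow> real ^ 'n \<Rightarrow> real" where
  "extd2 B p u v w =
     frechet_derivative (\<lambda>q. B q v w) (at p) u + frechet_derivative (\<lambda>q. B q w u) (at p) v
     + frechet_derivative (\<lambda>q. B q u v) (at p) w"

definition closed_two_form ::
  "(real ^ 'n::finite) set \<Rightarrow> (real ^ 'n \<Rightarrow> real ^ 'n \<Rightarrow> real ^ 'n \<Rightarrow> real) \<Rightarrow> bool" where
  "closed_two_form M B \<longleftrightarrow>
     (\<forall>u v. smooth_on M (\<lambda>p. B p u v)) \<and> (\<forall>p\<in>M. \<forall>u v w. extd2 B p u v w = 0)"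

definition local_flow :: "(real ^ 'n::finite) set \<Rightarrow> (real ^ 'n \<Rightarrow> real ^ 'n) \<Rightarrow>
    real \<Rightarrow> (real ^ 'n) set \<Rightarrow> (real \<Rightarrow> real ^ 'n \<Rightarrow> real ^ 'n) \<Rightarrow> bool" where
  "local_flow M X e U \<phi> \<longleftrightarrow>
     0 < e \<and> open U \<and> U \<subseteq> M \<and>
     smooth_on ({-e<..<e} \<times> U) (\<lambda>(s, p). \<phi> s p) \<and>
     (\<forall>p\<in>U. \<phi> 0 p = p) \<and>
     (\<forall>s\<in>{-e<..<e}. \<forall>p\<in>U. \<phi> s p \<in> M \<and>
        ((\<lambda>r. \<phi> r p) has_vector_derivative X (\<phi> s p)) (at s))"

definition flow_invariant :: "(real ^ 'n::finite) set \<Rightarrow> (real ^ 'n \<Rightarrow> real ^ 'n) \<Rightarrow>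
    (real ^ 'n \<Rightarrow> real ^ 'n \<Rightarrow> real ^ 'n \<Rightarrow> real) \<Rightarrow> bool" where
  "flow_invariant M X B \<longleftrightarrow>
     (\<forall>e U \<phi>. local_flow M X e U \<phi> \<longrightarrow>
        (\<forall>s\<in>{-e<..<e}. \<forall>p\<in>U. \<forall>u v.
           B (\<phi> s p) (frechet_derivative (\<phi> s) (at p) u) (frechet_derivative (\<phi> s) (at p) v)
           = B p u v))"

section \<open>Complexification\<close>

definition cv :: "real ^ 'n::finite \<Rightarrow> complex ^ 'n" where
  "cv x = (\<chi> i. complex_of_real (x $ i))"

definition rev_part :: "complex ^ 'n::finite \<Rightarrow> real ^ 'n" where
  "rev_part z = (\<chi> i. Re (z $ i))"

definition imv_part :: "complex ^ 'n::finite \<Rightarrow> real ^ 'n" where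
  "imv_part z = (\<chi> i. Im (z $ i))"

definition cbilin :: "(real ^ 'n::finite \<Rightarrow> real ^ 'n \<Rightarrow> real) \<Rightarrow> complex ^ 'n \<Rightarrow> complex ^ 'n \<Rightarrow> complex"
  where "cbilin B X Y =
    Complex (B (rev_part X) (rev_part Y) - B (imv_part X) (imv_part Y))
            (B (rev_part X) (imv_part Y) + B (imv_part X) (rev_part Y))"

text \<open>Derivative \<open>v(\<phi>)\<close> of a complex function along a complex tangent vector, and the
  complex bilinear extension of the Lie bracket.\<close>

definition cdir :: "complex ^ 'n::finite \<Rightarrow> (real ^ 'n \<Rightarrow> complex) \<Rightarrow> real ^ 'n \<Rightarrow> complex" where
  "cdir v \<phi> p = frechet_derivative \<phi> (at p) (rev_part v) + \<i> * frechet_derivative \<phi> (at p) (imv_part v)"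

definition lie_bracket :: "(real ^ 'n::finite \<Rightarrow> complex ^ 'n) \<Rightarrow> (real ^ 'n \<Rightarrow> complex ^ 'n) \<Rightarrow>
    real ^ 'n \<Rightarrow> complex ^ 'n" where
  "lie_bracket X Y p = (\<chi> k. cdir (X p) (\<lambda>q. Y q $ k) p - cdir (Y p) (\<lambda>q. X q $ k) p)"

text \<open>Smooth sections over \<open>U\<close> of a (not necessarily constant rank) family of subspaces of
  the complexified tangent spaces.\<close>

definition sections :: "(real ^ 'n::finite) set \<Rightarrow> (real ^ 'n \<Rightarrow> (complex ^ 'n) set) \<Rightarrow>
    (real ^ 'n \<Rightarrow> complex ^ 'n) set" where
  "sections U E = {X. smooth_on U X \<and> (\<forall>p\<in>U. X p \<in> E p)}"

section \<open>Generalized geometry\<close>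

text \<open>Fibres of the generalized tangent bundle and of its complexification: a pair \<open>(X, \<xi>)\<close>
  stands for \<open>X + \<xi>\<close>, so that \<open>fst\<close> and \<open>snd\<close> are the projections to the tangent and the
  cotangent part.\<close>

type_synonym 'n gtm = "(real ^ 'n) \<times> (real ^ 'n)"
type_synonym 'n gtmC = "(complex ^ 'n) \<times> (complex ^ 'n)"

definition pairing :: "'n::finite gtm \<Rightarrow> 'n gtm \<Rightarrow> real" where
  "pairing u v = (ev (snd v) (fst u) + ev (snd u) (fst v)) / 2"

definition cscale :: "complex \<Rightarrow> 'n::finite gtmC \<Rightarrow> 'n gtmC" where
  "cscale c u = (c *s fst u, c *s snd u)"

definition cg :: "'n::finite gtm \<Rightarrow> 'n gtmC" where
  "cg u = (cv (fst u), cv (snd u))"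

definition reg_part :: "'n::finite gtmC \<Rightarrow> 'n gtm" where
  "reg_part u = (rev_part (fst u), rev_part (snd u))"

definition img_part :: "'n::finite gtmC \<Rightarrow> 'n gtm" where
  "img_part u = (imv_part (fst u), imv_part (snd u))"

definition gconj :: "'n::finite gtmC \<Rightarrow> 'n gtmC" where
  "gconj u = cg (reg_part u) - cscale \<i> (cg (img_part u))"

definition cend :: "('n::finite gtm \<Rightarrow> 'n gtm) \<Rightarrow> 'n gtmC \<Rightarrow> 'n gtmC" where
  "cend A u = cg (A (reg_part u)) + cscale \<i> (cg (A (img_part u)))"

definition csubspace :: "'n::finite gtm set \<Rightarrow> 'n gtmC set" where
  "csubspace V = {u. reg_part u \<in> V \<and> img_part u \<in> V}"

definition eigen_i :: "('n::finite gtm \<Rightarrow> 'n gtm) \<Rightarrow> 'n gtmC set" where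
  "eigen_i A = {u. cend A u = cscale \<i> u}"

definition orth :: "'n::finite gtm set \<Rightarrow> 'n gtm set" where
  "orth V = {u. \<forall>v\<in>V. pairing u v = 0}"

text \<open>\<open>B\<close> is the (unique) two-form on \<open>E = fst ` L\<close> with
  \<open>L = {X + \<xi>. X \<in> E \<and> \<xi> restricted to E equals B(X, _)}\<close>; its values off \<open>E\<close> are irrelevant.\<close>

definition two_form_on ::
  "(complex ^ 'n::finite) set \<Rightarrow> (complex ^ 'n \<Rightarrow> complex ^ 'n \<Rightarrow> complex) \<Rightarrow> bool" where
  "two_form_on E B \<longleftrightarrow>
     (\<forall>X\<in>E. \<forall>Y\<in>E. B X Y = - B Y X) \<and>
     (\<forall>X\<in>E. \<forall>Y\<in>E. \<forall>Z\<in>E. \<forall>c. B (X + c *s Y) Z = B X Z + c * B Y Z)"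

definition presents ::
  "(complex ^ 'n::finite \<Rightarrow> complex ^ 'n \<Rightarrow> complex) \<Rightarrow> 'n gtmC set \<Rightarrow> bool" where
  "presents B L \<longleftrightarrow>
     two_form_on (fst ` L) B \<and>
     L = {(X, \<xi>). X \<in> fst ` L \<and> (\<forall>Y\<in>fst ` L. ev \<xi> Y = B X Y)}"

section \<open>The conditions (KK1)--(KK5)\<close>

text \<open>\<open>GE\<close> is the endomorphism of the generalized metric; \<open>eps1\<close> and \<open>eps2\<close> are meant to
  satisfy \<open>presents (eps1 p) (L1 p)\<close> and \<open>presents (eps2 p) (L2 p)\<close>. The locale has no
  assumptions and only serves to share parameters.\<close>

locale kk_data =
  fixes M :: "(real ^ 'n::finite) set"
    and GE J :: "real ^ 'n \<Rightarrow> 'n gtm \<Rightarrow> 'n gtm"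
    and X0 :: "real ^ 'n \<Rightarrow> real ^ 'n"
    and F :: "real ^ 'n \<Rightarrow> real ^ 'n \<Rightarrow> real ^ 'n \<Rightarrow> real"
    and a f h :: "real ^ 'n \<Rightarrow> real"
    and eps1 eps2 :: "real ^ 'n \<Rightarrow> complex ^ 'n \<Rightarrow> complex ^ 'n \<Rightarrow> complex"
begin

definition J2 :: "real ^ 'n \<Rightarrow> 'n gtm \<Rightarrow> 'n gtm" where
  "J2 p = GE p \<circ> J p"

definition J3 :: "real ^ 'n \<Rightarrow> 'n gtm \<Rightarrow> 'n gtm" where
  "J3 p = J p \<circ> J2 p"

definition L1 :: "real ^ 'n \<Rightarrow> 'n gtmC set" where
  "L1 p = eigen_i (J p)"

definition L2 :: "real ^ 'n \<Rightarrow> 'n gtmC set" where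
  "L2 p = eigen_i (J2 p)"

definition E1 :: "real ^ 'n \<Rightarrow> (complex ^ 'n) set" where
  "E1 p = fst ` L1 p"

definition gX0 :: "real ^ 'n \<Rightarrow> 'n gtm" where
  "gX0 p = (X0 p, 0)"

text \<open>\<open>G(X\<^sub>0, X\<^sub>0)\<close>, where \<open>G(u, v) = pairing (GE u) v\<close>.\<close>

definition GX0 :: "real ^ 'n \<Rightarrow> real" where
  "GX0 p = pairing (GE p (gX0 p)) (gX0 p)"

definition S :: "real ^ 'n \<Rightarrow> 'n gtm set" where
  "S p = span {gX0 p, J p (gX0 p), J2 p (gX0 p), J3 p (gX0 p)}"

definition SC :: "real ^ 'n \<Rightarrow> 'n gtmC set" where
  "SC p = csubspace (orth (S p))"

definition T12 :: "real ^ 'n \<Rightarrow> (complex ^ 'n) set" where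
  "T12 p = fst ` (L1 p \<inter> L2 p \<inter> SC p)"

definition T1b2 :: "real ^ 'n \<Rightarrow> (complex ^ 'n) set" where
  "T1b2 p = fst ` (L1 p \<inter> gconj ` L2 p \<inter> SC p)"

definition Tb12 :: "real ^ 'n \<Rightarrow> (complex ^ 'n) set" where
  "Tb12 p = fst ` (gconj ` L1 p \<inter> L2 p \<inter> SC p)"

definition T2 :: "real ^ 'n \<Rightarrow> (complex ^ 'n) set" where
  "T2 p = fst ` (L2 p \<inter> SC p)"

definition vf :: "real ^ 'n \<Rightarrow> 'n gtmC" where
  "vf p = cg (gX0 p) - cscale \<i> (cg (J p (gX0 p)))
     - cscale (of_real (1 / (f p)\<^sup>2)) (cg (J3 p (gX0 p)) + cscale \<i> (cg (J2 p (gX0 p))))"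

definition vif :: "real ^ 'n \<Rightarrow> 'n gtmC" where
  "vif p = cg (gX0 p) - cscale \<i> (cg (J p (gX0 p)))
     + cscale (of_real (1 / (f p)\<^sup>2)) (cg (J3 p (gX0 p)) + cscale \<i> (cg (J2 p (gX0 p))))"

definition alpha :: "real ^ 'n \<Rightarrow> real ^ 'n" where
  "alpha p = - diff0 (\<lambda>q. ln (\<bar>(f q)\<^sup>2 - 1\<bar> / ((f q)\<^sup>2 * GX0 q))) p"

text \<open>\<open>Z\<close> is the tangent part of \<open>\<J>\<^sub>3X\<^sub>0\<close>, and \<open>DZ X = [Z, X] + \<alpha>(X) Z\<close>.\<close>

definition Z :: "real ^ 'n \<Rightarrow> complex ^ 'n" where
  "Z p = cv (fst (J3 p (gX0 p)))"

definition DZ :: "(real ^ 'n \<Rightarrow> complex ^ 'n) \<Rightarrow> real ^ 'n \<Rightarrow> complex ^ 'n" where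
  "DZ X p = lie_bracket Z X p + ev (cv (alpha p)) (X p) *s Z p"

definition Deps2 ::
  "(real ^ 'n \<Rightarrow> complex ^ 'n) \<Rightarrow> (real ^ 'n \<Rightarrow> complex ^ 'n) \<Rightarrow> real ^ 'n \<Rightarrow> complex" where
  "Deps2 X Y p = cdir (Z p) (\<lambda>q. eps2 q (X q) (Y q)) p
     - eps2 p (DZ X p) (Y p) - eps2 p (X p) (DZ Y p)"

definition dh :: "real ^ 'n \<Rightarrow> complex ^ 'n" where
  "dh p = cv (diff0 h p)"

definition KK1 :: bool where
  "KK1 \<longleftrightarrow>
     (\<forall>p\<in>M.
        (\<forall>X\<in>T12 p. \<forall>Y\<in>T12 p. cbilin (F p) X Y = 0) \<and>
        (\<forall>X\<in>T1b2 p. \<forall>Y\<in>T1b2 p. cbilin (F p) X Y = 0) \<and>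
        (\<forall>X\<in>E1 p. \<forall>Y\<in>E1 p. cbilin (F p) X Y *s cv (X0 p) \<in> E1 p))"

definition KK2 :: bool where
  "KK2 \<longleftrightarrow>
     (\<forall>U. open U \<and> U \<subseteq> M \<longrightarrow>
        (\<forall>X\<in>sections U T12.
           (\<lambda>p. DZ X p
              + (of_real ((f p)\<^sup>2) * cbilin (F p) (fst (vf p)) (X p)
                 / of_real (a p * ((f p)\<^sup>2 - 1))) *s cv (X0 p)) \<in> sections U T12) \<and>
        (\<forall>X\<in>sections U T1b2.
           (\<lambda>p. DZ X p
              - (of_real ((f p)\<^sup>2) * cbilin (F p) (fst (vif p)) (X p)
                 / of_real (a p * ((f p)\<^sup>2 - 1))) *s cv (X0 p)) \<in> sections U T1b2))"

definition KK3 :: bool where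
  "KK3 \<longleftrightarrow>
     (\<forall>p\<in>M. \<forall>X\<in>fst ` orth (S p).
        frechet_derivative (\<lambda>q. a q * (f q)\<^sup>2 * (h q)\<^sup>2) (at p) X = 0)"

definition KK4 :: bool where
  "KK4 \<longleftrightarrow>
     (\<forall>p\<in>M.
        (\<forall>X\<in>E1 p. \<forall>Y\<in>E1 p. \<forall>W\<in>E1 p.
           wedge12 (eps1 p (cv (X0 p))) (cbilin (F p)) X Y W
           = - of_real (2 * a p / h p) * wedge21 (eps1 p) (ev (dh p)) X Y W) \<and>
        (\<forall>X\<in>T12 p. \<forall>Y\<in>Tb12 p. \<forall>W\<in>T2 p. wedge21 (eps2 p) (ev (dh p)) X Y W = 0))"

definition KK5 :: bool where
  "KK5 \<longleftrightarrow>
     (\<forall>U. open U \<and> U \<subseteq> M \<longrightarrow>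
        (\<forall>X\<in>sections U T2. \<forall>Y\<in>sections U T2. \<forall>p\<in>U.
           cbilin (extd1 (\<lambda>q. ((1 - (f q)\<^sup>2) / ((f q)\<^sup>2 * GX0 q)) *\<^sub>R snd (J3 q (gX0 q))) p) (X p) (Y p)
           + of_real (((f p)\<^sup>2 - 1) / ((f p)\<^sup>2 * GX0 p)) * Deps2 X Y p
           + of_real (2 / (a p * (f p)\<^sup>2)) * cbilin (F p) (X p) (Y p)
           = of_real (2 / (h p * GX0 p)) *
               (ev (dh p) (fst (vf p)) * eps2 p (X p) (Y p)
                + wedge (snd (vf p)) (dh p) (X p) (Y p))))"

end

section \<open>Toric generalized Kaehler structures in dimension four\<close>

text \<open>Coordinates are indexed by \<open>2 + 2\<close>: \<open>t\<^sup>i\<close> has index \<open>Inl i\<close> and \<open>\<mu>\<^sup>i\<close> has index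
  \<open>Inr i\<close>. (In the type \<open>2\<close> the numeral \<open>2\<close> denotes \<open>0\<close>, the index different from \<open>1\<close>.)
  The coordinate vectors are \<open>Dt\<close>, \<open>Dmu\<close> and the dual coordinate covectors \<open>dt\<close>, \<open>dmu\<close>;
  they have the same components.\<close>

definition Dt :: "2 \<Rightarrow> real ^ (2 + 2)" where "Dt i = axis (Inl i) 1"
definition Dmu :: "2 \<Rightarrow> real ^ (2 + 2)" where "Dmu i = axis (Inr i) 1"
definition dt :: "2 \<Rightarrow> real ^ (2 + 2)" where "dt i = axis (Inl i) 1"
definition dmu :: "2 \<Rightarrow> real ^ (2 + 2)" where "dmu i = axis (Inr i) 1"

definition mu :: "real ^ (2 + 2) \<Rightarrow> real ^ 2" where
  "mu p = (\<chi> i. p $ Inr i)"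

definition hess :: "(real ^ 2 \<Rightarrow> real) \<Rightarrow> real ^ 2 \<Rightarrow> real ^ 2 ^ 2" where
  "hess \<tau> x = (\<chi> i j. pd i (pd j \<tau>) x)"

definition Psi :: "(real ^ 2 \<Rightarrow> real) \<Rightarrow> real ^ 2 ^ 2 \<Rightarrow> real ^ 2 \<Rightarrow> real ^ 2 ^ 2" where
  "Psi \<tau> C x = hess \<tau> x + C"

text \<open>\<open>(\<Psi>\<^sub>1\<^sub>2)\<^sup>s / \<Psi>\<^sub>2\<^sub>2\<close>.\<close>

definition Psi_ratio :: "(real ^ 2 \<Rightarrow> real) \<Rightarrow> real ^ 2 ^ 2 \<Rightarrow> real ^ 2 \<Rightarrow> real" where
  "Psi_ratio \<tau> C x = ((Psi \<tau> C x $ 1 $ 2 + Psi \<tau> C x $ 2 $ 1) / 2) / Psi \<tau> C x $ 2 $ 2"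

definition omega :: "real ^ (2 + 2) \<Rightarrow> real ^ (2 + 2) \<Rightarrow> real" where
  "omega X Y = (\<Sum>i\<in>UNIV. wedge (dmu i) (dt i) X Y)"

definition omega_map :: "real ^ (2 + 2) \<Rightarrow> real ^ (2 + 2)" where
  "omega_map X = (\<chi> k. omega X (axis k 1))"

definition J_plus :: "(real ^ 2 \<Rightarrow> real) \<Rightarrow> real ^ 2 ^ 2 \<Rightarrow> real ^ (2 + 2) \<Rightarrow>
    real ^ (2 + 2) \<Rightarrow> real ^ (2 + 2)" where
  "J_plus \<tau> C p X =
     (\<Sum>i\<in>UNIV. \<Sum>j\<in>UNIV. (Psi \<tau> C (mu p) $ i $ j * ev (dmu j) X) *\<^sub>R Dt i)
     - (\<Sum>i\<in>UNIV. \<Sum>j\<in>UNIV. (matrix_inv (Psi \<tau> C (mu p)) $ i $ j * ev (dt j) X) *\<^sub>R Dmu i)"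

definition J_minus :: "(real ^ 2 \<Rightarrow> real) \<Rightarrow> real ^ 2 ^ 2 \<Rightarrow> real ^ (2 + 2) \<Rightarrow>
    real ^ (2 + 2) \<Rightarrow> real ^ (2 + 2)" where
  "J_minus \<tau> C p X =
     (\<Sum>i\<in>UNIV. \<Sum>j\<in>UNIV. (Psi \<tau> C (mu p) $ j $ i * ev (dmu j) X) *\<^sub>R Dt i)
     - (\<Sum>i\<in>UNIV. \<Sum>j\<in>UNIV. (matrix_inv (Psi \<tau> C (mu p)) $ j $ i * ev (dt j) X) *\<^sub>R Dmu i)"

definition g_map :: "(real ^ 2 \<Rightarrow> real) \<Rightarrow> real ^ 2 ^ 2 \<Rightarrow> real ^ (2 + 2) \<Rightarrow>
    real ^ (2 + 2) \<Rightarrow> real ^ (2 + 2)" where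
  "g_map \<tau> C p X = - (1 / 2) *\<^sub>R omega_map (J_plus \<tau> C p X + J_minus \<tau> C p X)"

definition b_map :: "(real ^ 2 \<Rightarrow> real) \<Rightarrow> real ^ 2 ^ 2 \<Rightarrow> real ^ (2 + 2) \<Rightarrow>
    real ^ (2 + 2) \<Rightarrow> real ^ (2 + 2)" where
  "b_map \<tau> C p X = - (1 / 2) *\<^sub>R omega_map (J_plus \<tau> C p X - J_minus \<tau> C p X)"

text \<open>Since \<open>C\<^sub>+\<close> and \<open>C\<^sub>-\<close> are complementary, these clauses determine \<open>GE\<close> and \<open>J\<close> on \<open>M\<close>.\<close>

definition toric_structure :: "(real ^ (2 + 2)) set \<Rightarrow> (real ^ 2 \<Rightarrow> real) \<Rightarrow> real ^ 2 ^ 2 \<Rightarrow>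
    (real ^ (2 + 2) \<Rightarrow> (2 + 2) gtm \<Rightarrow> (2 + 2) gtm) \<Rightarrow>
    (real ^ (2 + 2) \<Rightarrow> (2 + 2) gtm \<Rightarrow> (2 + 2) gtm) \<Rightarrow> bool" where
  "toric_structure M \<tau> C GE J \<longleftrightarrow>
     (\<forall>p\<in>M.
        let g = g_map \<tau> C p; b = b_map \<tau> C p; Jp = J_plus \<tau> C p; Jm = J_minus \<tau> C p in
          linear (GE p) \<and> linear (J p) \<and>
          (\<forall>X. GE p (X, b X + g X) = (X, b X + g X) \<and>
               GE p (X, b X - g X) = - (X, b X - g X) \<and>
               J p (X, b X + g X) = (Jp X, b (Jp X) + g (Jp X)) \<and>
               J p (X, b X - g X) = (Jm X, b (Jm X) - g (Jm X))))"

end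

theory Submission
  imports Defs
begin

text \<open>
  The explicit data are much simpler than they look. From \<open>a h\<^sup>2 = k\<^sub>0\<close> and \<open>a' = - \<lambda>\<^sub>0\<close> one gets
  \<open>2 a h' / h = \<lambda>\<^sub>0\<close>, and therefore \<open>F = \<lambda>\<^sub>0 \<omega>\<close> has constant coefficients. Closedness and invariance
  follow at once, the flow of \<open>X\<^sub>0\<close> being a translation, and \<open>da = - i\<^bsub>X\<^sub>0\<^esub> F\<close> because
  \<open>i\<^bsub>X\<^sub>0\<^esub> \<omega> = d\<mu>\<^sup>1\<close>.

  The rest is linear algebra in a fibre, where \<open>Hess(\<tau>) = (P, q; q, r)\<close> and \<open>C\<^sub>1\<^sub>2 = c\<close>, followed by
  one differentiation. In a fibre, \<open>\<J>\<^sub>2\<close> and hence \<open>\<epsilon>\<^sub>2 = - i \<omega>\<close> are constant; \<open>C\<^sub>1\<^sub>2 \<noteq> 0\<close> makes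
  \<open>E\<^sub>1\<close> the whole complexified tangent space, and \<open>\<epsilon>\<^sub>1 \<and> \<omega> = 0\<close>
  (lemma \<open>eps1_wedge_omega\<close>), which gives (KK4). As \<open>d\<mu>\<^sup>1 = \<J>\<^sub>2X\<^sub>0\<close> belongs to \<open>\<S>\<close>, all tangent
  vectors coming from the orthogonal complement of \<open>\<S>\<close> satisfy \<open>d\<mu>\<^sup>1 = 0\<close>; since \<open>h\<close> and \<open>f\<^sup>2\<close>
  depend only on \<open>\<mu>\<^sup>1\<close>, their differentials vanish there. The two spaces in (KK1) and (KK2)
  are lines, spanned by
  \<open>\<partial>/\<partial>\<mu>\<^sup>2 - i ((q \<plusminus> c) \<partial>/\<partial>t\<^sup>1 + r \<partial>/\<partial>t\<^sup>2)\<close> (lemma \<open>tangent_of_L1_L2\<close>).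

  With \<open>\<rho> = r / det Hess(\<tau>) = 2 G(X\<^sub>0, X\<^sub>0)\<close> and \<open>s = q / r\<close> the tangent part of \<open>\<J>\<^sub>3X\<^sub>0\<close> is
  \<open>Z = - c \<rho> (s \<partial>/\<partial>t\<^sup>1 + \<partial>/\<partial>t\<^sup>2)\<close>. On vectors with \<open>d\<mu>\<^sup>1 = 0\<close> the form \<open>\<alpha>\<close> is \<open>d ln \<rho>\<close>, and
  \<open>[Z, X] + \<alpha>(X) Z\<close> is the derivative of \<open>X\<close> along \<open>Z\<close> plus \<open>c \<rho> (\<partial>s/\<partial>\<mu>\<^sup>2) d\<mu>\<^sup>2(X) \<partial>/\<partial>t\<^sup>1\<close>
  (lemma \<open>DZ_eq\<close>). The definition of \<open>f\<^sup>2\<close> says exactly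
  \<open>\<partial>s/\<partial>\<mu>\<^sup>2 = - \<lambda>\<^sub>0 (f\<^sup>2 + 1) / (a (f\<^sup>2 - 1))\<close>. This makes the extra term cancel in (KK2), and turns
  (KK5) into an identity between multiples of \<open>\<omega>\<close>.

  Apart from this, two analytic facts are used: \<open>Hess(\<tau>)\<close> is symmetric
  (lemma \<open>second_derivative_symmetric\<close>), and smooth maps are closed under the operations that
  produce the section in (KK2).
\<close>

section \<open>Calculus of smooth maps on open sets\<close>

lemma frechet_derivative_eqI:
  "(f has_derivative f') (at x) \<Longrightarrow> frechet_derivative f (at x) v = f' v"
  by (metis frechet_derivative_at)

lemma has_frechet_derivative:
  "f differentiable (at x) \<Longrightarrow> (f has_derivative frechet_derivative f (at x)) (at x)"
  by (simp add: frechet_derivative_works)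

lemma frechet_derivative_cong_open:
  assumes "open U" "x \<in> U" "\<And>y. y \<in> U \<Longrightarrow> f y = g y"
  shows "frechet_derivative f (at x) = frechet_derivative g (at x)"
proof -
  have "(f has_derivative D) (at x) \<longleftrightarrow> (g has_derivative D) (at x)" for D
    using has_derivative_transform_within_open[OF _ assms(1,2)] assms(3) by metis
  then show ?thesis by (simp add: frechet_derivative_def)
qed

lemma differentiable_cong_open:
  assumes "open U" "x \<in> U" "\<And>y. y \<in> U \<Longrightarrow> f y = g y" "f differentiable (at x)"
  shows "g differentiable (at x)"
  using has_derivative_transform_within_open[OF _ assms(1,2)] assms(3,4)
  unfolding differentiable_def by metis

lemma differentiable_upto_subset:
  "differentiable_upto k U f \<Longrightarrow> V \<subseteq> U \<Longrightarrow> differentiable_upto k V f"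
  by (induction k arbitrary: f) (auto intro: continuous_on_subset)

lemma differentiable_upto_cong:
  assumes "open U"
  shows "(\<And>x. x \<in> U \<Longrightarrow> f x = g x) \<Longrightarrow> differentiable_upto k U f \<Longrightarrow> differentiable_upto k U g"
proof (induction k arbitrary: f g)
  case 0
  then show ?case using continuous_on_cong[of U U f g] by simp
next
  case (Suc k)
  have "differentiable_upto k U (\<lambda>x. frechet_derivative g (at x) v)" for v
    by (rule Suc.IH[of "\<lambda>x. frechet_derivative f (at x) v"])
      (use Suc.prems frechet_derivative_cong_open[OF assms, of _ f g] in auto)
  then show ?case
    using Suc.prems differentiable_cong_open[OF assms, of _ f g] by auto
qed

text \<open>Induction on the order of differentiability loses one order at each use of the product rule,
  whose terms contain the undifferentiated factors.\<close>

lemma differentiable_upto_Suc_imp: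
  "differentiable_upto (Suc k) U f \<Longrightarrow> differentiable_upto k U f"
proof (induction k arbitrary: f)
  case 0
  then show ?case
    by (auto intro: continuous_at_imp_continuous_on differentiable_imp_continuous_within)
next
  case (Suc k)
  then show ?case by (metis differentiable_upto.simps(2))
qed

lemma differentiable_upto_add:
  assumes "open U"
  shows "differentiable_upto k U f \<Longrightarrow> differentiable_upto k U g
    \<Longrightarrow> differentiable_upto k U (\<lambda>x. f x + g x)"
proof (induction k arbitrary: f g)
  case 0
  then show ?case by (simp add: continuous_on_add)
next
  case (Suc k)
  have deriv: "((\<lambda>x. f x + g x) has_derivative
      (\<lambda>v. frechet_derivative f (at x) v + frechet_derivative g (at x) v)) (at x)" if "x \<in> U" for x
    using Suc.prems that by (auto intro!: has_derivative_add has_frechet_derivative)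
  have "differentiable_upto k U (\<lambda>x. frechet_derivative (\<lambda>x. f x + g x) (at x) v)" for v
    by (rule differentiable_upto_cong[OF assms, where
          f = "\<lambda>x. frechet_derivative f (at x) v + frechet_derivative g (at x) v"])
      (use Suc frechet_derivative_eqI[OF deriv] in auto)
  then show ?case using deriv by (auto simp: differentiable_def)
qed

lemma differentiable_upto_scaleR:
  assumes "open U"
  shows "differentiable_upto k U f \<Longrightarrow> differentiable_upto k U g
    \<Longrightarrow> differentiable_upto k U (\<lambda>x. f x *\<^sub>R g x)"
proof (induction k arbitrary: f g)
  case 0
  then show ?case by (simp add: continuous_on_scaleR)
next
  case (Suc k)
  have deriv: "((\<lambda>x. f x *\<^sub>R g x) has_derivative
      (\<lambda>v. f x *\<^sub>R frechet_derivative g (at x) v + frechet_derivative f (at x) v *\<^sub>R g x)) (at x)"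
    if "x \<in> U" for x
    using Suc.prems that by (auto intro!: has_derivative_scaleR has_frechet_derivative)
  have "differentiable_upto k U (\<lambda>x. frechet_derivative (\<lambda>x. f x *\<^sub>R g x) (at x) v)" for v
    by (rule differentiable_upto_cong[OF assms, where
          f = "\<lambda>x. f x *\<^sub>R frechet_derivative g (at x) v + frechet_derivative f (at x) v *\<^sub>R g x"])
      (use Suc Suc.prems[THEN differentiable_upto_Suc_imp] frechet_derivative_eqI[OF deriv] in
        \<open>auto intro!: differentiable_upto_add[OF assms]\<close>)
  then show ?case using deriv by (auto simp: differentiable_def)
qed

lemma smooth_on_subset: "smooth_on U f \<Longrightarrow> V \<subseteq> U \<Longrightarrow> smooth_on V f"
  unfolding smooth_on_def using differentiable_upto_subset by blast

lemma smooth_on_cong: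
  "open U \<Longrightarrow> smooth_on U f \<Longrightarrow> (\<And>x. x \<in> U \<Longrightarrow> f x = g x) \<Longrightarrow> smooth_on U g"
  unfolding smooth_on_def using differentiable_upto_cong by blast

lemma smooth_on_differentiable: "smooth_on U f \<Longrightarrow> x \<in> U \<Longrightarrow> f differentiable (at x)"
  unfolding smooth_on_def by (metis differentiable_upto.simps(2))

lemma smooth_on_continuous: "smooth_on U f \<Longrightarrow> continuous_on U f"
  unfolding smooth_on_def by (metis differentiable_upto.simps(1))

lemma smooth_on_frechet_derivative:
  "smooth_on U f \<Longrightarrow> smooth_on U (\<lambda>x. frechet_derivative f (at x) v)"
  unfolding smooth_on_def by (metis differentiable_upto.simps(2))

lemma smooth_on_const: "smooth_on U (\<lambda>x. c)"
proof -
  have "differentiable_upto k U (\<lambda>x. c)" for k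
    by (induction k arbitrary: c) (auto simp: frechet_derivative_const)
  then show ?thesis by (simp add: smooth_on_def)
qed

lemma smooth_on_add:
  "open U \<Longrightarrow> smooth_on U f \<Longrightarrow> smooth_on U g \<Longrightarrow> smooth_on U (\<lambda>x. f x + g x)"
  by (simp add: smooth_on_def differentiable_upto_add)

lemma smooth_on_scaleR:
  "open U \<Longrightarrow> smooth_on U f \<Longrightarrow> smooth_on U g \<Longrightarrow> smooth_on U (\<lambda>x. f x *\<^sub>R g x)"
  by (simp add: smooth_on_def differentiable_upto_scaleR)

lemma smooth_on_mult:
  fixes f g :: "'a::real_normed_vector \<Rightarrow> real"
  shows "open U \<Longrightarrow> smooth_on U f \<Longrightarrow> smooth_on U g \<Longrightarrow> smooth_on U (\<lambda>x. f x * g x)"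
  using smooth_on_scaleR[of U f g] by simp

lemma smooth_on_diff:
  fixes f g :: "'a::real_normed_vector \<Rightarrow> real"
  assumes "open U" "smooth_on U f" "smooth_on U g"
  shows "smooth_on U (\<lambda>x. f x - g x)"
  using smooth_on_add[OF assms(1,2) smooth_on_scaleR[OF assms(1) smooth_on_const assms(3)], of "-1"]
  by simp

text \<open>The derivative of \<open>1 / f\<close> is a product of \<open>1 / f\<close>, \<open>1 / f\<close> and a derivative of \<open>f\<close>, so
  each further order of differentiability of \<open>1 / f\<close> follows from the preceding one.\<close>

lemma smooth_on_inverse:
  fixes f :: "'a::real_normed_vector \<Rightarrow> real"
  assumes "open U" "smooth_on U f" "\<And>x. x \<in> U \<Longrightarrow> f x \<noteq> 0"
  shows "smooth_on U (\<lambda>x. inverse (f x))"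
proof -
  have "differentiable_upto k U (\<lambda>x. inverse (f x))" for k
  proof (induction k)
    case 0
    then show ?case using assms(3) smooth_on_continuous[OF assms(2)]
      by (auto intro!: continuous_on_inverse)
  next
    case (Suc k)
    have deriv: "((\<lambda>x. inverse (f x)) has_derivative
        (\<lambda>v. inverse (f x) *\<^sub>R inverse (f x) *\<^sub>R (- 1) *\<^sub>R frechet_derivative f (at x) v)) (at x)"
      if "x \<in> U" for x
      using Deriv.has_derivative_inverse[OF assms(3)[OF that]
          has_frechet_derivative[OF smooth_on_differentiable[OF assms(2) that]]]
      by (simp add: algebra_simps)
    have "differentiable_upto k U
        (\<lambda>x. inverse (f x) *\<^sub>R inverse (f x) *\<^sub>R (- 1) *\<^sub>R frechet_derivative f (at x) v)" for v
      using smooth_on_frechet_derivative[OF assms(2), of v] smooth_on_const[of U "- 1 :: real"]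
      by (intro differentiable_upto_scaleR[OF assms(1)] Suc) (auto simp: smooth_on_def)
    then have "differentiable_upto k U (\<lambda>x. frechet_derivative (\<lambda>x. inverse (f x)) (at x) v)" for v
      by (rule differentiable_upto_cong[OF assms(1), rotated])
        (use frechet_derivative_eqI[OF deriv] in auto)
    then show ?case using deriv by (auto simp: differentiable_def)
  qed
  then show ?thesis by (simp add: smooth_on_def)
qed

lemma smooth_on_divide:
  fixes f g :: "'a::real_normed_vector \<Rightarrow> real"
  assumes "open U" "smooth_on U f" "smooth_on U g" "\<And>x. x \<in> U \<Longrightarrow> g x \<noteq> 0"
  shows "smooth_on U (\<lambda>x. f x / g x)"
  using smooth_on_mult[OF assms(1,2) smooth_on_inverse[OF assms(1,3,4)]]
  by (simp add: divide_inverse)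

lemma has_derivative_compose_linear:
  assumes "bounded_linear l" "f differentiable (at (l x))"
  shows "((\<lambda>x. f (l x)) has_derivative (\<lambda>v. frechet_derivative f (at (l x)) (l v))) (at x)"
  using has_derivative_compose[OF bounded_linear_imp_has_derivative[OF assms(1)]
      has_frechet_derivative[OF assms(2)]] by simp

lemma smooth_on_compose_linear:
  assumes "open U" "bounded_linear l" "smooth_on (l ` U) f"
  shows "smooth_on U (\<lambda>x. f (l x))"
proof -
  have "differentiable_upto k (l ` U) f \<Longrightarrow> differentiable_upto k U (\<lambda>x. f (l x))" for k
  proof (induction k arbitrary: f)
    case 0
    then show ?case
      using continuous_on_compose2[of "l ` U" f U l] linear_continuous_on[OF assms(2)] by auto
  next
    case (Suc k)
    have deriv: "((\<lambda>x. f (l x)) has_derivative (\<lambda>v. frechet_derivative f (at (l x)) (l v))) (at x)"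
      if "x \<in> U" for x
      using has_derivative_compose_linear[OF assms(2)] Suc.prems that by auto
    have "differentiable_upto k U (\<lambda>x. frechet_derivative (\<lambda>x. f (l x)) (at x) v)" for v
      by (rule differentiable_upto_cong[OF assms(1), where
            f = "\<lambda>x. frechet_derivative f (at (l x)) (l v)"])
        (use Suc.IH[of "\<lambda>y. frechet_derivative f (at y) (l v)"] Suc.prems
          frechet_derivative_eqI[OF deriv] in auto)
    then show ?case using deriv by (auto simp: differentiable_def)
  qed
  then show ?thesis using assms(3) by (simp add: smooth_on_def)
qed

text \<open>The mixed difference of \<open>f\<close> over the parallelogram at \<open>x\<close> spanned by \<open>s *\<^sub>R u\<close> and
  \<open>s *\<^sub>R v\<close> is, by the mean value theorem applied in one direction and then in the other, a
  mixed second derivative at some point of that parallelogram.\<close>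

lemma mixed_difference_mean_value:
  fixes f :: "'a::real_normed_vector \<Rightarrow> real"
  assumes f: "\<And>y. y \<in> U \<Longrightarrow> f differentiable (at y)"
    and f': "\<And>y. y \<in> U \<Longrightarrow> (\<lambda>z. frechet_derivative f (at z) u) differentiable (at y)"
    and U: "\<And>y z. 0 \<le> y \<Longrightarrow> y \<le> s \<Longrightarrow> 0 \<le> z \<Longrightarrow> z \<le> s \<Longrightarrow> x + y *\<^sub>R u + z *\<^sub>R v \<in> U"
    and "0 < s"
  obtains y z where "0 \<le> y" "y \<le> s" "0 \<le> z" "z \<le> s"
    "f (x + s *\<^sub>R u + s *\<^sub>R v) - f (x + s *\<^sub>R u) - f (x + s *\<^sub>R v) + f x =
      s * s * frechet_derivative (\<lambda>w. frechet_derivative f (at w) u) (at (x + y *\<^sub>R u + z *\<^sub>R v)) v"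
proof -
  have line: "((\<lambda>t. g (w + t *\<^sub>R d)) has_real_derivative frechet_derivative g (at (w + t *\<^sub>R d)) d) (at t)"
    if "g differentiable (at (w + t *\<^sub>R d))" for g :: "'a \<Rightarrow> real" and w d t
  proof -
    have "((\<lambda>t. w + t *\<^sub>R d) has_derivative (\<lambda>t. t *\<^sub>R d)) (at t)"
      by (auto intro!: derivative_eq_intros)
    from has_derivative_compose[OF this has_frechet_derivative[OF that]]
    show ?thesis
      using linear_frechet_derivative[OF that]
      by (simp add: has_field_derivative_def linear_cmul mult_commute_abs)
  qed
  define \<phi> where "\<phi> t = f (x + s *\<^sub>R v + t *\<^sub>R u) - f (x + t *\<^sub>R u)" for t
  have "\<exists>y>0. y < s \<and> \<phi> s - \<phi> 0 = (s - 0) *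
      (frechet_derivative f (at (x + s *\<^sub>R v + y *\<^sub>R u)) u - frechet_derivative f (at (x + y *\<^sub>R u)) u)"
  proof (rule MVT2[OF \<open>0 < s\<close>])
    fix t assume "0 \<le> t" "t \<le> s"
    then have "x + s *\<^sub>R v + t *\<^sub>R u \<in> U" "x + t *\<^sub>R u \<in> U"
      using U[of t s] U[of t 0] \<open>0 < s\<close> by (simp_all add: algebra_simps)
    then show "(\<phi> has_real_derivative frechet_derivative f (at (x + s *\<^sub>R v + t *\<^sub>R u)) u
        - frechet_derivative f (at (x + t *\<^sub>R u)) u) (at t)"
      unfolding \<phi>_def using f by (intro DERIV_diff line) auto
  qed
  then obtain y where y: "0 < y" "y < s" "\<phi> s - \<phi> 0 = s *
      (frechet_derivative f (at (x + s *\<^sub>R v + y *\<^sub>R u)) u - frechet_derivative f (at (x + y *\<^sub>R u)) u)"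
    by auto
  define \<psi> where "\<psi> t = frechet_derivative f (at (x + y *\<^sub>R u + t *\<^sub>R v)) u" for t
  have "\<exists>z>0. z < s \<and> \<psi> s - \<psi> 0 = (s - 0) *
      frechet_derivative (\<lambda>w. frechet_derivative f (at w) u) (at (x + y *\<^sub>R u + z *\<^sub>R v)) v"
    using f' U y unfolding \<psi>_def by (intro MVT2[OF \<open>0 < s\<close>] line) auto
  then obtain z where z: "0 < z" "z < s" "\<psi> s - \<psi> 0 = s *
      frechet_derivative (\<lambda>w. frechet_derivative f (at w) u) (at (x + y *\<^sub>R u + z *\<^sub>R v)) v"
    by auto
  have swap: "x + y *\<^sub>R u + s *\<^sub>R v = x + s *\<^sub>R v + y *\<^sub>R u" by (simp add: algebra_simps)
  have "\<phi> s - \<phi> 0 = s * (\<psi> s - \<psi> 0)" unfolding \<psi>_def swap y(3) by simp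
  moreover have "\<phi> s - \<phi> 0 =
      f (x + s *\<^sub>R u + s *\<^sub>R v) - f (x + s *\<^sub>R u) - f (x + s *\<^sub>R v) + f x"
    by (simp add: \<phi>_def algebra_simps)
  ultimately show ?thesis using that[of y z] y z by auto
qed

text \<open>Both mixed derivatives are limits of the same mixed difference quotients.\<close>

lemma second_derivative_symmetric:
  fixes f :: "'a::real_normed_vector \<Rightarrow> real"
  assumes "open U" "x \<in> U" "smooth_on U f"
  shows "frechet_derivative (\<lambda>y. frechet_derivative f (at y) u) (at x) v =
         frechet_derivative (\<lambda>y. frechet_derivative f (at y) v) (at x) u"
proof -
  define D where "D u v w = frechet_derivative (\<lambda>y. frechet_derivative f (at y) u) (at w) v" for u v w
  have diff: "f differentiable (at y)" "(\<lambda>z. frechet_derivative f (at z) w) differentiable (at y)"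
    if "y \<in> U" for y w
    using smooth_on_differentiable[OF _ that] smooth_on_frechet_derivative[OF assms(3)] assms(3)
    by auto
  have cont: "isCont (D u v) x" for u v
    using smooth_on_continuous[OF smooth_on_frechet_derivative[OF smooth_on_frechet_derivative[OF assms(3)]]]
      continuous_on_eq_continuous_at[OF assms(1)] assms(2) unfolding D_def by blast
  have near_D: "\<exists>d>0. \<forall>y. dist y x < d \<longrightarrow> dist (D u v y) (D u v x) < e / 2" if "e > 0" for u v e
    using cont[of u v] half_gt_zero[OF that] unfolding continuous_at_eps_delta by blast
  have "\<bar>D u v x - D v u x\<bar> \<le> e" if e: "e > 0" for e
  proof -
    obtain d1 where d1: "d1 > 0" "\<And>y. dist y x < d1 \<Longrightarrow> dist (D u v y) (D u v x) < e / 2"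
      using near_D[OF e, of u v] by blast
    obtain d2 where d2: "d2 > 0" "\<And>y. dist y x < d2 \<Longrightarrow> dist (D v u y) (D v u x) < e / 2"
      using near_D[OF e, of v u] by blast
    obtain d3 where d3: "d3 > 0" "ball x d3 \<subseteq> U" using assms(1,2) open_contains_ball by blast
    define d where "d = Min {d1, d2, d3}"
    have d: "d > 0" "d \<le> d1" "d \<le> d2" "d \<le> d3" using d1 d2 d3 by (auto simp: d_def)
    define s where "s = d / (2 * (norm u + norm v + 1))"
    have s: "s > 0" using d by (simp add: s_def add_nonneg_pos)
    have near: "dist (x + y *\<^sub>R u + z *\<^sub>R v) x < d" if "0 \<le> y" "y \<le> s" "0 \<le> z" "z \<le> s" for y z
    proof -
      have "dist (x + y *\<^sub>R u + z *\<^sub>R v) x \<le> y * norm u + z * norm v"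
        using norm_triangle_ineq[of "y *\<^sub>R u" "z *\<^sub>R v"] that by (simp add: dist_norm)
      also have "\<dots> \<le> s * (norm u + norm v + 1)"
        using mult_right_mono[OF that(2), of "norm u"] mult_right_mono[OF that(4), of "norm v"] s
        by (simp add: algebra_simps)
      also have "\<dots> = d / 2"
      proof -
        have "norm u + norm v + 1 \<noteq> 0" using norm_ge_zero[of u] norm_ge_zero[of v] by linarith
        moreover have "d / (2 * N) * N = d / 2" if "N \<noteq> 0" for N using that by simp
        ultimately show ?thesis unfolding s_def by blast
      qed
      finally show ?thesis using d by simp
    qed
    have inU: "x + y *\<^sub>R u + z *\<^sub>R v \<in> U" if "0 \<le> y" "y \<le> s" "0 \<le> z" "z \<le> s" for y z
      using near[OF that] d(4) d3(2) by (auto simp: dist_commute)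
    obtain y z where 1: "0 \<le> y" "y \<le> s" "0 \<le> z" "z \<le> s"
      "f (x + s *\<^sub>R u + s *\<^sub>R v) - f (x + s *\<^sub>R u) - f (x + s *\<^sub>R v) + f x
        = s * s * D u v (x + y *\<^sub>R u + z *\<^sub>R v)"
      using mixed_difference_mean_value[of U f u s x v, OF diff inU s] unfolding D_def by blast
    have inU': "x + y *\<^sub>R v + z *\<^sub>R u \<in> U" if "0 \<le> y" "y \<le> s" "0 \<le> z" "z \<le> s" for y z
      using inU[OF that(3,4,1,2)] by (simp add: algebra_simps)
    obtain y' z' where 2: "0 \<le> y'" "y' \<le> s" "0 \<le> z'" "z' \<le> s"
      "f (x + s *\<^sub>R v + s *\<^sub>R u) - f (x + s *\<^sub>R v) - f (x + s *\<^sub>R u) + f x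
        = s * s * D v u (x + y' *\<^sub>R v + z' *\<^sub>R u)"
      using mixed_difference_mean_value[of U f v s x u, OF diff inU' s] unfolding D_def by blast
    have "s * s * D u v (x + y *\<^sub>R u + z *\<^sub>R v) = s * s * D v u (x + z' *\<^sub>R u + y' *\<^sub>R v)"
      using 1(5) 2(5) by (simp add: algebra_simps)
    then have "D u v (x + y *\<^sub>R u + z *\<^sub>R v) = D v u (x + z' *\<^sub>R u + y' *\<^sub>R v)" using s by simp
    moreover have "dist (D u v (x + y *\<^sub>R u + z *\<^sub>R v)) (D u v x) < e / 2"
      using near[OF 1(1-4)] d by (intro d1) auto
    moreover have "dist (D v u (x + z' *\<^sub>R u + y' *\<^sub>R v)) (D v u x) < e / 2"
      using near[OF 2(3,4,1,2)] d by (intro d2) auto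
    ultimately show ?thesis unfolding dist_real_def by argo
  qed
  from this[of "\<bar>D u v x - D v u x\<bar> / 2"] have "D u v x = D v u x" by force
  then show ?thesis by (simp add: D_def)
qed

section \<open>Complexified calculus in coordinates\<close>

lemma frechet_derivative_expand:
  fixes f :: "real ^ 'n::finite \<Rightarrow> 'b::real_normed_vector"
  assumes "f differentiable (at p)"
  shows "frechet_derivative f (at p) v = (\<Sum>k\<in>UNIV. v $ k *\<^sub>R frechet_derivative f (at p) (axis k 1))"
proof -
  note lin = linear_frechet_derivative[OF assms]
  have "v = (\<Sum>k\<in>UNIV. v $ k *\<^sub>R axis k 1)"
    using basis_expansion[of v] by (simp add: scalar_mult_eq_scaleR)
  then have "frechet_derivative f (at p) v
      = frechet_derivative f (at p) (\<Sum>k\<in>UNIV. v $ k *\<^sub>R axis k 1)" by simp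
  also have "\<dots> = (\<Sum>k\<in>UNIV. v $ k *\<^sub>R frechet_derivative f (at p) (axis k 1))"
    by (simp add: linear_sum[OF lin] linear_cmul[OF lin])
  finally show ?thesis .
qed

lemma ev_diff0:
  "\<psi> differentiable (at p) \<Longrightarrow> ev (diff0 \<psi> p) v = frechet_derivative \<psi> (at p) v"
  by (simp add: ev_def diff0_def pd_def frechet_derivative_expand[of \<psi> p v] mult.commute)

lemma cdir_expand:
  fixes \<phi> :: "real ^ 'n::finite \<Rightarrow> complex"
  assumes "\<phi> differentiable (at p)"
  shows "cdir v \<phi> p = (\<Sum>k\<in>UNIV. v $ k * frechet_derivative \<phi> (at p) (axis k 1))"
proof -
  have "v $ k * z = Re (v $ k) *\<^sub>R z + \<i> * (Im (v $ k) *\<^sub>R z)" for k z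
    by (simp add: complex_eq_iff)
  then have "(\<Sum>k\<in>UNIV. v $ k * frechet_derivative \<phi> (at p) (axis k 1)) =
      (\<Sum>k\<in>UNIV. rev_part v $ k *\<^sub>R frechet_derivative \<phi> (at p) (axis k 1)) +
      \<i> * (\<Sum>k\<in>UNIV. imv_part v $ k *\<^sub>R frechet_derivative \<phi> (at p) (axis k 1))"
    by (simp add: rev_part_def imv_part_def sum.distrib sum_distrib_left)
  then show ?thesis
    unfolding cdir_def frechet_derivative_expand[OF assms, symmetric] by simp
qed

lemma has_derivative_complex_of_real:
  "(\<psi> has_derivative D) F \<Longrightarrow> ((\<lambda>q. complex_of_real (\<psi> q)) has_derivative (\<lambda>v. of_real (D v))) F"
  by (rule bounded_linear.has_derivative[OF bounded_linear_of_real])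

lemma differentiable_complex_of_real:
  "\<psi> differentiable F \<Longrightarrow> (\<lambda>q. complex_of_real (\<psi> q)) differentiable F"
  unfolding differentiable_def using has_derivative_complex_of_real by blast

lemma cdir_of_real:
  fixes \<psi> :: "real ^ 'n::finite \<Rightarrow> real"
  assumes "\<psi> differentiable (at p)"
  shows "cdir v (\<lambda>q. of_real (\<psi> q)) p = ev (cv (diff0 \<psi> p)) v"
  using frechet_derivative_eqI[OF has_derivative_complex_of_real[OF has_frechet_derivative[OF assms]]]
  by (simp add: cdir_expand[OF differentiable_complex_of_real[OF assms]] ev_def cv_def diff0_def
      pd_def mult.commute)

lemma cdir_const: "cdir v (\<lambda>q. c) p = 0"
  by (simp add: cdir_def frechet_derivative_const)

lemma cdir_cong_open:
  assumes "open U" "p \<in> U" "\<And>q. q \<in> U \<Longrightarrow> \<phi> q = \<psi> q"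
  shows "cdir v \<phi> p = cdir v \<psi> p"
  using frechet_derivative_cong_open[OF assms] by (simp add: cdir_def)

lemma cdir_cv:
  "cdir (cv w) \<phi> p = frechet_derivative \<phi> (at p) w" if "\<phi> differentiable (at p)"
proof -
  have "rev_part (cv w) = w" "imv_part (cv w) = 0"
    by (simp_all add: vec_eq_iff rev_part_def imv_part_def cv_def)
  then show ?thesis by (simp add: cdir_def linear_0[OF linear_frechet_derivative[OF that]])
qed

lemma ev_add_left: "ev (\<xi> + \<eta>) X = ev \<xi> X + ev \<eta> X"
  by (simp add: ev_def algebra_simps sum.distrib)

lemma ev_scaleR_left: "ev (c *\<^sub>R \<xi>) X = c * ev \<xi> X" for c :: real
  by (simp add: ev_def sum_distrib_left algebra_simps)

lemma ev_cv: "ev (cv \<xi>) X = Complex (ev \<xi> (rev_part X)) (ev \<xi> (imv_part X))"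
  by (simp add: ev_def cv_def rev_part_def imv_part_def complex_eq_iff)

lemma cbilin_wedge: "cbilin (wedge \<xi> \<eta>) X Y = wedge (cv \<xi>) (cv \<eta>) X Y"
  by (simp add: cbilin_def wedge_def ev_cv complex_eq_iff algebra_simps)

lemma cbilin_add:
  "cbilin (\<lambda>u v. A u v + B u v) X Y = cbilin A X Y + cbilin B X Y"
  by (simp add: cbilin_def complex_eq_iff algebra_simps)

lemma cbilin_scale: "cbilin (\<lambda>u v. c * B u v) X Y = of_real c * cbilin B X Y"
  by (simp add: cbilin_def complex_eq_iff algebra_simps)

lemma extd1_scaleR:
  fixes \<psi> :: "real ^ 'n::finite \<Rightarrow> real"
  assumes "\<psi> differentiable (at p)"
  shows "extd1 (\<lambda>q. \<psi> q *\<^sub>R \<eta>) p = wedge (diff0 \<psi> p) \<eta>"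
proof -
  have "((\<lambda>q. \<psi> q * c) has_derivative (\<lambda>v. frechet_derivative \<psi> (at p) v * c)) (at p)" for c
    by (intro has_derivative_mult_left has_frechet_derivative assms)
  note eq = frechet_derivative_eqI[OF this]
  show ?thesis
    by (intro ext) (simp add: extd1_def wedge_def ev_scaleR_left ev_diff0[OF assms] eq)
qed

lemma extd1_add:
  fixes \<beta> \<gamma> :: "real ^ 'n::finite \<Rightarrow> real ^ 'n"
  assumes "\<And>v. (\<lambda>q. ev (\<beta> q) v) differentiable (at p)" "\<And>v. (\<lambda>q. ev (\<gamma> q) v) differentiable (at p)"
  shows "extd1 (\<lambda>q. \<beta> q + \<gamma> q) p = (\<lambda>u v. extd1 \<beta> p u v + extd1 \<gamma> p u v)"
  by (intro ext) (simp add: extd1_def ev_add_left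
      frechet_derivative_eqI[OF has_derivative_add[OF assms[THEN has_frechet_derivative]]])

lemma extd1_cong_open:
  assumes "open U" "p \<in> U" "\<And>q. q \<in> U \<Longrightarrow> \<beta> q = \<gamma> q"
  shows "extd1 \<beta> p = extd1 \<gamma> p"
proof -
  have "frechet_derivative (\<lambda>q. ev (\<beta> q) v) (at p) = frechet_derivative (\<lambda>q. ev (\<gamma> q) v) (at p)" for v
    by (rule frechet_derivative_cong_open[OF assms(1,2)]) (simp add: assms(3))
  then show ?thesis by (intro ext) (simp add: extd1_def)
qed

text \<open>Nothing is known about the regularity of \<open>\<Phi>\<close>, so the chain rule does not apply; but \<open>\<phi>\<close> is
  constant near \<open>p\<close> on the line through \<open>p\<close> in direction \<open>v\<close>.\<close>

lemma frechet_derivative_one_coordinate: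
  fixes \<phi> :: "real ^ 'n::finite \<Rightarrow> 'b::real_normed_vector"
  assumes "open U" "p \<in> U" "\<And>q. q \<in> U \<Longrightarrow> \<phi> q = \<Phi> (q $ k)"
    and "\<phi> differentiable (at p)" and "v $ k = 0"
  shows "frechet_derivative \<phi> (at p) v = 0"
proof -
  obtain e where e: "e > 0" "ball p e \<subseteq> U" using assms(1,2) open_contains_ball by blast
  have line: "((\<lambda>t. p + t *\<^sub>R v) has_derivative (\<lambda>t. t *\<^sub>R v)) (at 0)"
    by (auto intro!: derivative_eq_intros)
  have "((\<lambda>t. \<phi> (p + t *\<^sub>R v)) has_derivative (\<lambda>t. frechet_derivative \<phi> (at p) (t *\<^sub>R v))) (at 0)"
    using has_derivative_compose[OF line, of \<phi> "frechet_derivative \<phi> (at p)"]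
      has_frechet_derivative[OF assms(4)] by simp
  moreover have "((\<lambda>t. \<phi> (p + t *\<^sub>R v)) has_derivative (\<lambda>t. 0)) (at 0)"
  proof (rule has_derivative_transform_within_open[where s = "(\<lambda>t. p + t *\<^sub>R v) -` ball p e"])
    show "((\<lambda>t. \<phi> p) has_derivative (\<lambda>t. 0)) (at (0::real))" by simp
    show "open ((\<lambda>t. p + t *\<^sub>R v) -` ball p e)"
      by (intro open_vimage continuous_intros) auto
    show "\<phi> p = \<phi> (p + t *\<^sub>R v)" if "t \<in> (\<lambda>t. p + t *\<^sub>R v) -` ball p e" for t
      using that e(2) assms(2,3,5) by (auto simp: subset_iff)
  qed (use e in auto)
  ultimately have "(\<lambda>t. frechet_derivative \<phi> (at p) (t *\<^sub>R v)) = (\<lambda>t. 0 :: 'b)"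
    by (rule has_derivative_unique)
  from fun_cong[OF this, of 1] show ?thesis by simp
qed

section \<open>Linear algebra of a single fibre\<close>

lemma sum_22: "(\<Sum>k\<in>(UNIV::(2 + 2) set). f k) = f (Inl 1) + f (Inl 2) + f (Inr 1) + f (Inr 2)"
  by (simp add: UNIV_Plus_UNIV[symmetric] sum.Plus sum_2 add.assoc del: UNIV_Plus_UNIV)

lemma forall_22: "(\<forall>k::2 + 2. R k) \<longleftrightarrow> R (Inl 1) \<and> R (Inl 2) \<and> R (Inr 1) \<and> R (Inr 2)"
  by (auto simp: split_sum_all forall_2)

lemma vec22_eq_iff:
  "X = Y \<longleftrightarrow> X $ Inl 1 = Y $ Inl 1 \<and> X $ Inl 2 = Y $ Inl 2 \<and> X $ Inr 1 = Y $ Inr 1 \<and> X $ Inr 2 = Y $ Inr 2"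
  for X Y :: "'a ^ (2 + 2)"
  by (simp add: vec_eq_iff forall_22)

definition tm_vec :: "'a \<Rightarrow> 'a \<Rightarrow> 'a \<Rightarrow> 'a \<Rightarrow> 'a ^ (2 + 2)" where
  "tm_vec t1 t2 m1 m2 =
     (\<chi> k. case k of Inl i \<Rightarrow> if i = 1 then t1 else t2 | Inr i \<Rightarrow> if i = 1 then m1 else m2)"

lemma tm_vec_nth [simp]:
  "tm_vec t1 t2 m1 m2 $ Inl 1 = t1" "tm_vec t1 t2 m1 m2 $ Inl 2 = t2"
  "tm_vec t1 t2 m1 m2 $ Inr 1 = m1" "tm_vec t1 t2 m1 m2 $ Inr 2 = m2"
  by (simp_all add: tm_vec_def)

text \<open>In terms of a symmetric matrix \<open>H = (P, q; q, r)\<close> and \<open>C = (0, c; - c, 0)\<close>, \<open>toric_J\<close> is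
  the complex structure of \<open>\<Psi> = H + C\<close>; the transpose of \<open>\<Psi>\<close> is obtained by \<open>c \<mapsto> - c\<close>.\<close>

definition toric_J :: "real \<Rightarrow> real \<Rightarrow> real \<Rightarrow> real \<Rightarrow> real ^ (2 + 2) \<Rightarrow> real ^ (2 + 2)" where
  "toric_J P q r c X =
     tm_vec (P * X $ Inr 1 + (q + c) * X $ Inr 2) ((q - c) * X $ Inr 1 + r * X $ Inr 2)
       (((q + c) * X $ Inl 2 - r * X $ Inl 1) / (P * r - q\<^sup>2 + c\<^sup>2))
       (((q - c) * X $ Inl 1 - P * X $ Inl 2) / (P * r - q\<^sup>2 + c\<^sup>2))"

definition toric_g :: "real \<Rightarrow> real \<Rightarrow> real \<Rightarrow> real \<Rightarrow> real ^ (2 + 2) \<Rightarrow> real ^ (2 + 2)" where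
  "toric_g P q r c X =
     tm_vec ((r * X $ Inl 1 - q * X $ Inl 2) / (P * r - q\<^sup>2 + c\<^sup>2))
       ((P * X $ Inl 2 - q * X $ Inl 1) / (P * r - q\<^sup>2 + c\<^sup>2))
       (P * X $ Inr 1 + q * X $ Inr 2) (q * X $ Inr 1 + r * X $ Inr 2)"

definition toric_b :: "real \<Rightarrow> real \<Rightarrow> real \<Rightarrow> real \<Rightarrow> real ^ (2 + 2) \<Rightarrow> real ^ (2 + 2)" where
  "toric_b P q r c X =
     tm_vec (- (c * X $ Inl 2) / (P * r - q\<^sup>2 + c\<^sup>2)) (c * X $ Inl 1 / (P * r - q\<^sup>2 + c\<^sup>2))
       (c * X $ Inr 2) (- (c * X $ Inr 1))"

text \<open>Block forms of \<open>G\<^sup>e\<^sup>n\<^sup>d\<close> and of \<open>\<J>\<close> with \<open>D = det \<Psi>\<close> and \<open>k = 1 / det H\<close>, and of \<open>\<J>\<^sub>2\<close>. They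
  are polynomial in their parameters, so that the same expressions describe their complex linear
  extensions.\<close>

definition GE_form :: "'a \<Rightarrow> 'a \<Rightarrow> 'a \<Rightarrow> 'a \<Rightarrow> 'a \<Rightarrow> 'a \<Rightarrow>
    ('a::comm_ring_1 ^ (2 + 2)) \<times> ('a ^ (2 + 2)) \<Rightarrow> ('a ^ (2 + 2)) \<times> ('a ^ (2 + 2))" where
  "GE_form P q r c D k u =
    (let x1 = fst u $ Inl 1; x2 = fst u $ Inl 2; m1 = fst u $ Inr 1; m2 = fst u $ Inr 2;
         a1 = snd u $ Inl 1; a2 = snd u $ Inl 2; n1 = snd u $ Inr 1; n2 = snd u $ Inr 2 in
     (tm_vec (k * (P * (D * a1 + c * x2) + q * (D * a2 - c * x1)))
             (k * (q * (D * a1 + c * x2) + r * (D * a2 - c * x1)))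
             (k * (r * (n1 - c * m2) - q * (n2 + c * m1)))
             (k * (P * (n2 + c * m1) - q * (n1 - c * m2))),
      tm_vec (k * (r * x1 - q * x2 - c * (q * a1 + r * a2)))
             (k * (P * x2 - q * x1 + c * (P * a1 + q * a2)))
             (k * (c * (P * n2 - q * n1) + D * (P * m1 + q * m2)))
             (k * (D * (q * m1 + r * m2) - c * (r * n1 - q * n2)))))"

definition J2_form :: "('a::comm_ring_1 ^ (2 + 2)) \<times> ('a ^ (2 + 2)) \<Rightarrow> ('a ^ (2 + 2)) \<times> ('a ^ (2 + 2))"
  where "J2_form u =
    (tm_vec (snd u $ Inr 1) (snd u $ Inr 2) (- (snd u $ Inl 1)) (- (snd u $ Inl 2)),
     tm_vec (fst u $ Inr 1) (fst u $ Inr 2) (- (fst u $ Inl 1)) (- (fst u $ Inl 2)))"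

abbreviation J_form where "J_form P q r c D k u \<equiv> GE_form P q r c D k (J2_form u)"

lemma linear_GE_form: "linear (GE_form P q r c D k)" for P :: real
  by (rule linearI) (simp_all add: GE_form_def Let_def prod_eq_iff vec22_eq_iff algebra_simps)

lemma linear_J2_form: "linear (J2_form :: (2 + 2) gtm \<Rightarrow> _)"
  by (rule linearI) (simp_all add: J2_form_def prod_eq_iff vec22_eq_iff algebra_simps)

lemma cend_GE_form:
  "cend (GE_form P q r c D k) =
   GE_form (of_real P) (of_real q) (of_real r) (of_real c) (of_real D) (of_real k)"
  by (rule ext)
    (simp add: cend_def GE_form_def Let_def prod_eq_iff vec22_eq_iff cg_def cscale_def cv_def
      reg_part_def img_part_def rev_part_def imv_part_def complex_eq_iff)

lemma cend_J2_form: "cend J2_form = J2_form"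
  by (rule ext)
    (simp add: cend_def J2_form_def prod_eq_iff vec22_eq_iff cg_def cscale_def cv_def
      reg_part_def img_part_def rev_part_def imv_part_def complex_eq_iff)

lemma cend_compose:
  assumes "linear A" "linear B"
  shows "cend (\<lambda>u. A (B u)) u = cend A (cend B u)"
proof -
  have "reg_part (cend B u) = B (reg_part u)" "img_part (cend B u) = B (img_part u)" for u
    by (simp_all add: cend_def cg_def cscale_def cv_def reg_part_def img_part_def rev_part_def
        imv_part_def prod_eq_iff vec_eq_iff)
  then show ?thesis by (simp add: cend_def)
qed

text \<open>The complex linear extension of a real operator commutes with conjugation, which turns the
  eigenvalue \<open>i\<close> into \<open>- i\<close>.\<close>

lemma in_gconj_eigen_i:
  assumes "linear A"
  shows "u \<in> gconj ` eigen_i A \<longleftrightarrow> cend A u = cscale (- \<i>) u"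
proof -
  have inv: "gconj (gconj u) = u" for u :: "(_, 'a) vec \<times> _"
    by (simp add: gconj_def cg_def cscale_def cv_def reg_part_def img_part_def rev_part_def
        imv_part_def prod_eq_iff vec_eq_iff complex_eq_iff)
  have parts: "reg_part (gconj u) = reg_part u" "img_part (gconj u) = - img_part u" for u :: "(_, 'a) vec \<times> _"
    by (simp_all add: gconj_def cg_def cscale_def cv_def reg_part_def img_part_def rev_part_def
        imv_part_def prod_eq_iff vec_eq_iff)
  have "cend A (gconj u) = gconj (cend A u)"
    by (simp add: cend_def parts linear_neg[OF assms])
      (simp add: gconj_def cg_def cscale_def cv_def reg_part_def img_part_def rev_part_def
        imv_part_def prod_eq_iff vec_eq_iff complex_eq_iff)
  moreover have "gconj (cscale c u) = cscale (cnj c) (gconj u)" for c u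
    by (simp add: gconj_def cg_def cscale_def cv_def reg_part_def img_part_def rev_part_def
        imv_part_def prod_eq_iff vec_eq_iff complex_eq_iff)
  ultimately have "cend A (gconj u) = cscale \<i> (gconj u) \<longleftrightarrow> cend A u = cscale (- \<i>) u"
    by (metis inv complex_cnj_i complex_cnj_minus complex_cnj_cnj)
  then show ?thesis
    by (metis (mono_tags, lifting) eigen_i_def image_iff inv mem_Collect_eq)
qed

lemma orth_span:
  "orth (span B) = {u. \<forall>v\<in>B. pairing u v = 0}"
proof -
  have add: "pairing u (v + w) = pairing u v + pairing u w" for u v w :: "(real, 'a) vec \<times> _"
    by (simp add: pairing_def ev_def algebra_simps sum.distrib add_divide_distrib)
  have scale: "pairing u (s *\<^sub>R v) = s * pairing u v" for s and u v :: "(real, 'a) vec \<times> _"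
    by (simp add: pairing_def ev_def sum_distrib_left algebra_simps add_divide_distrib)
  have "linear (pairing u)" for u :: "(real, 'a) vec \<times> _"
    using add scale by (intro linearI) auto
  then have "\<forall>v\<in>span B. pairing u v = 0" if "\<forall>v\<in>B. pairing u v = 0" for u
    using that by (meson linear_eq_0_on_span)
  then show ?thesis using span_base by (fastforce simp: orth_def)
qed

text \<open>The operators \<open>G\<^sup>e\<^sup>n\<^sup>d\<close> and \<open>\<J>\<close> at a point where \<open>Hess(\<tau>) = (P, q; q, r)\<close> and \<open>C\<^sub>1\<^sub>2 = c\<close>.\<close>

locale toric_fibre =
  fixes P q r c :: real and A J :: "(2 + 2) gtm \<Rightarrow> (2 + 2) gtm"
  assumes r_pos: "r > 0" and det_pos: "P * r - q\<^sup>2 > 0" and c_nonzero: "c \<noteq> 0"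
    and linear_A: "linear A" and linear_J: "linear J"
    and A_plus: "A (X, toric_b P q r c X + toric_g P q r c X) = (X, toric_b P q r c X + toric_g P q r c X)"
    and A_minus: "A (X, toric_b P q r c X - toric_g P q r c X) = - (X, toric_b P q r c X - toric_g P q r c X)"
    and J_plus: "J (X, toric_b P q r c X + toric_g P q r c X) =
      (toric_J P q r c X, toric_b P q r c (toric_J P q r c X) + toric_g P q r c (toric_J P q r c X))"
    and J_minus: "J (X, toric_b P q r c X - toric_g P q r c X) =
      (toric_J P q r (- c) X, toric_b P q r c (toric_J P q r (- c) X) - toric_g P q r c (toric_J P q r (- c) X))"
begin

definition \<Delta> :: real where "\<Delta> = P * r - q\<^sup>2"
definition D :: real where "D = P * r - q\<^sup>2 + c\<^sup>2"

lemma \<Delta>_pos: "\<Delta> > 0" using det_pos by (simp add: \<Delta>_def)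
lemma D_pos: "D > 0" using det_pos by (simp add: D_def add_pos_nonneg)

text \<open>Since \<open>g\<close> is invertible, every \<open>X + \<xi>\<close> is half the sum of an element of \<open>C\<^sub>+\<close> over \<open>X + Y\<close> and
  one of \<open>C\<^sub>-\<close> over \<open>X - Y\<close>, where \<open>g Y = \<xi> - b X\<close>.\<close>

lemma eq_on_C:
  assumes "linear S" "linear T"
    and "\<And>X. S (X, toric_b P q r c X + toric_g P q r c X) = T (X, toric_b P q r c X + toric_g P q r c X)"
    and "\<And>X. S (X, toric_b P q r c X - toric_g P q r c X) = T (X, toric_b P q r c X - toric_g P q r c X)"
  shows "S = T"
proof
  fix u :: "(2 + 2) gtm"
  obtain X \<xi> where u: "u = (X, \<xi>)" by force
  let ?b = "toric_b P q r c" and ?g = "toric_g P q r c"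
  define \<eta> where "\<eta> = \<xi> - ?b X"
  \<comment> \<open>the solution of \<open>g Y = \<eta>\<close>, by Cramer's rule in each of the two blocks\<close>
  define Y where "Y = tm_vec (D * (P * \<eta> $ Inl 1 + q * \<eta> $ Inl 2) / \<Delta>) (D * (q * \<eta> $ Inl 1 + r * \<eta> $ Inl 2) / \<Delta>)
    ((r * \<eta> $ Inr 1 - q * \<eta> $ Inr 2) / \<Delta>) ((P * \<eta> $ Inr 2 - q * \<eta> $ Inr 1) / \<Delta>)"
  have gY: "?g Y = \<eta>"
    using D_pos \<Delta>_pos
    apply (simp add: toric_g_def Y_def vec22_eq_iff flip: D_def)
    apply (simp add: divide_simps)
    apply (simp add: \<Delta>_def algebra_simps power2_eq_square)
    done
  define v where "v = (X + Y, ?b (X + Y) + ?g (X + Y))"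
  define w where "w = (X - Y, ?b (X - Y) - ?g (X - Y))"
  have "?b X + ?g Y = \<xi>" using gY by (simp add: \<eta>_def)
  moreover have "?b (X + Y) + ?g (X + Y) + (?b (X - Y) - ?g (X - Y)) = 2 *\<^sub>R (?b X + ?g Y)"
    by (simp add: toric_b_def toric_g_def vec22_eq_iff flip: D_def)
      (use D_pos in \<open>simp add: field_simps\<close>)
  ultimately have "u = (1 / 2) *\<^sub>R (v + w)"
    by (simp add: u v_def w_def scaleR_2)
  moreover have "S v = T v" "S w = T w" unfolding v_def w_def by (fact assms)+
  ultimately show "S u = T u"
    by (simp only: linear_cmul[OF assms(1)] linear_cmul[OF assms(2)]
        linear_add[OF assms(1)] linear_add[OF assms(2)])
qed

lemma A_eq: "A = GE_form P q r c D (1 / \<Delta>)"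
proof (rule eq_on_C[OF linear_A linear_GE_form])
  fix X
  show "A (X, toric_b P q r c X + toric_g P q r c X) =
      GE_form P q r c D (1 / \<Delta>) (X, toric_b P q r c X + toric_g P q r c X)"
    unfolding A_plus using D_pos \<Delta>_pos
    apply (simp add: GE_form_def Let_def prod_eq_iff vec22_eq_iff toric_b_def toric_g_def flip: D_def)
    apply (simp add: divide_simps)
    apply (simp add: \<Delta>_def D_def algebra_simps power2_eq_square)
    done
  show "A (X, toric_b P q r c X - toric_g P q r c X) =
      GE_form P q r c D (1 / \<Delta>) (X, toric_b P q r c X - toric_g P q r c X)"
    unfolding A_minus using D_pos \<Delta>_pos
    apply (simp add: GE_form_def Let_def prod_eq_iff vec22_eq_iff toric_b_def toric_g_def flip: D_def)
    apply (simp add: divide_simps)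
    apply (simp add: \<Delta>_def D_def algebra_simps power2_eq_square)
    done
qed

lemma AJ_eq: "A \<circ> J = J2_form"
proof (rule eq_on_C[OF linear_compose[OF linear_J linear_A] linear_J2_form])
  fix X
  show "(A \<circ> J) (X, toric_b P q r c X + toric_g P q r c X) =
      J2_form (X, toric_b P q r c X + toric_g P q r c X)"
    unfolding comp_apply J_plus A_plus using D_pos
    apply (simp add: J2_form_def prod_eq_iff vec22_eq_iff toric_b_def toric_g_def toric_J_def flip: D_def)
    apply (simp add: divide_simps)
    apply (simp add: D_def algebra_simps power2_eq_square)
    done
  show "(A \<circ> J) (X, toric_b P q r c X - toric_g P q r c X) =
      J2_form (X, toric_b P q r c X - toric_g P q r c X)"
    unfolding comp_apply J_minus A_minus using D_pos
    apply (simp add: J2_form_def prod_eq_iff vec22_eq_iff toric_b_def toric_g_def toric_J_def flip: D_def)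
    apply (simp add: divide_simps)
    apply (simp add: D_def algebra_simps power2_eq_square)
    done
qed

text \<open>\<open>G\<^sup>e\<^sup>n\<^sup>d\<close> is an involution, so \<open>\<J>\<close> is recovered from \<open>\<J>\<^sub>2 = G\<^sup>e\<^sup>n\<^sup>d \<J>\<close>, which has constant
  coefficients.\<close>

lemma J_eq: "J u = GE_form P q r c D (1 / \<Delta>) (J2_form u)"
proof -
  have "A \<circ> A = id"
    by (rule eq_on_C[OF linear_compose[OF linear_A linear_A] linear_id])
      (simp_all only: comp_apply A_plus A_minus linear_neg[OF linear_A] minus_minus id_apply)
  then have "J u = A ((A \<circ> J) u)" by (metis comp_apply id_apply)
  then show ?thesis unfolding AJ_eq unfolding A_eq .
qed

lemma cend_J: "cend J u =
    GE_form (of_real P) (of_real q) (of_real r) (of_real c) (of_real D) (of_real (1 / \<Delta>)) (J2_form u)"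
  unfolding J_eq[THEN ext] cend_compose[OF linear_GE_form linear_J2_form] cend_GE_form cend_J2_form ..

lemma cend_AJ: "cend (A \<circ> J) = J2_form"
  by (simp add: AJ_eq cend_J2_form)

abbreviation gX :: "(2 + 2) gtm" where "gX \<equiv> (- Dt 1, 0)"

lemma J_gX: "J gX = (tm_vec 0 0 (r / \<Delta>) (- (q / \<Delta>)), tm_vec 0 0 (- (c * q / \<Delta>)) (- (c * r / \<Delta>)))"
  by (simp add: J_eq GE_form_def J2_form_def prod_eq_iff vec22_eq_iff Dt_def axis_def)

lemma J2_gX: "A (J gX) = (0, tm_vec 0 0 1 0)"
  using fun_cong[OF AJ_eq, of gX] by (simp add: J2_form_def prod_eq_iff vec22_eq_iff Dt_def axis_def)

lemma J3_gX: "J (A (J gX)) =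
    (tm_vec (- (c * q / \<Delta>)) (- (c * r / \<Delta>)) 0 0, tm_vec (r / \<Delta>) (- (q / \<Delta>)) 0 0)"
  unfolding J2_gX by (simp add: J_eq GE_form_def J2_form_def prod_eq_iff vec22_eq_iff)

lemma G_gX: "pairing (A gX) gX = r / (2 * \<Delta>)"
  by (simp add: A_eq GE_form_def pairing_def ev_def sum_22 Dt_def axis_def)

definition Sperp :: "(2 + 2) gtm set" where
  "Sperp = orth (span {gX, J gX, (A \<circ> J) gX, (J \<circ> (A \<circ> J)) gX})"

lemma Sperp_iff:
  "u \<in> Sperp \<longleftrightarrow> snd u $ Inl 1 = 0 \<and> fst u $ Inr 1 = 0 \<and>
     r * fst u $ Inl 1 - q * fst u $ Inl 2 = c * r * snd u $ Inl 2 \<and>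
     r * snd u $ Inr 1 - q * snd u $ Inr 2 = c * r * fst u $ Inr 2"
proof -
  have 1: "pairing u gX = 0 \<longleftrightarrow> snd u $ Inl 1 = 0"
    by (simp add: pairing_def ev_def sum_22 Dt_def axis_def)
  have 2: "pairing u (A (J gX)) = 0 \<longleftrightarrow> fst u $ Inr 1 = 0"
    by (simp add: J2_gX pairing_def ev_def sum_22)
  have 3: "pairing u (J (A (J gX))) =
      (r * fst u $ Inl 1 - q * fst u $ Inl 2 - c * r * snd u $ Inl 2 - c * q * snd u $ Inl 1) / (2 * \<Delta>)"
    by (simp add: J3_gX pairing_def ev_def sum_22 diff_divide_distrib add_divide_distrib algebra_simps)
  have 4: "pairing u (J gX) =
      (r * snd u $ Inr 1 - q * snd u $ Inr 2 - c * r * fst u $ Inr 2 - c * q * fst u $ Inr 1) / (2 * \<Delta>)"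
    by (simp add: J_gX pairing_def ev_def sum_22 diff_divide_distrib add_divide_distrib algebra_simps)
  show ?thesis using \<Delta>_pos by (auto simp: Sperp_def orth_span 1 2 3 4)
qed

lemma csubspace_Sperp_iff:
  "u \<in> csubspace Sperp \<longleftrightarrow> snd u $ Inl 1 = 0 \<and> fst u $ Inr 1 = 0 \<and>
     of_real r * fst u $ Inl 1 - of_real q * fst u $ Inl 2 = of_real (c * r) * snd u $ Inl 2 \<and>
     of_real r * snd u $ Inr 1 - of_real q * snd u $ Inr 2 = of_real (c * r) * fst u $ Inr 2"
  by (auto simp: csubspace_def Sperp_iff reg_part_def img_part_def rev_part_def imv_part_def
      complex_eq_iff)

text \<open>On \<open>L\<^sub>1 \<inter> L\<^sub>2\<close> (\<open>\<sigma> = 1\<close>) and \<open>L\<^sub>1 \<inter> L\<^sub>2\<close>-bar (\<open>\<sigma> = - 1\<close>) the endomorphism \<open>\<J>\<^sub>3\<close> is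
  \<open>- \<sigma>\<close>, so these are the \<open>(1,0)\<close>-parts of \<open>C\<^sub>+\<close> and \<open>C\<^sub>-\<close>, and they project to the \<open>(1,0)\<close>-vectors
  of the complex structures with matrix \<open>H + \<sigma> C\<close>. Orthogonality to \<open>\<S>\<close> selects the line
  \<open>d\<mu>\<^sup>1 = 0\<close>.\<close>

lemma tangent_of_L1_L2:
  assumes "\<sigma> = 1 \<or> \<sigma> = - 1"
  shows "fst ` ({u. cend J u = cscale \<i> u} \<inter> {u. J2_form u = cscale (of_real \<sigma> * \<i>) u} \<inter> csubspace Sperp)
    = {X. X $ Inr 1 = 0 \<and> X $ Inl 1 = - \<i> * of_real (q + \<sigma> * c) * X $ Inr 2
        \<and> X $ Inl 2 = - \<i> * of_real r * X $ Inr 2}" (is "?L = ?R")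
proof -
  have J2_iff: "J2_form u = cscale (of_real \<sigma> * \<i>) u \<longleftrightarrow>
      snd u = tm_vec (- of_real \<sigma> * \<i> * fst u $ Inr 1) (- of_real \<sigma> * \<i> * fst u $ Inr 2)
        (of_real \<sigma> * \<i> * fst u $ Inl 1) (of_real \<sigma> * \<i> * fst u $ Inl 2)" for u :: "(2 + 2) gtmC"
    using assms by (auto simp: J2_form_def cscale_def prod_eq_iff vec22_eq_iff complex_eq_iff)
  have "X \<in> ?R" if "X \<in> ?L" for X
  proof -
    from that obtain \<xi> where u: "cend J (X, \<xi>) = cscale \<i> (X, \<xi>)"
      "J2_form (X, \<xi>) = cscale (of_real \<sigma> * \<i>) (X, \<xi>)" "(X, \<xi>) \<in> csubspace Sperp"
      by auto
    have m1: "X $ Inr 1 = 0" using u(3) by (simp add: csubspace_Sperp_iff)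
    have \<xi>: "\<xi> $ Inl 1 = 0" "\<xi> $ Inl 2 = - of_real \<sigma> * \<i> * X $ Inr 2"
      using u(2) m1 by (simp_all add: J2_iff)
    have "of_real (1 / \<Delta>) *
        (of_real P * (- X $ Inl 2) - of_real q * (of_real c * \<xi> $ Inl 2 - X $ Inl 1)) = \<i> * X $ Inr 2"
      using arg_cong[OF u(1), of "\<lambda>u. fst u $ Inr 2"] \<xi>(1)
      by (simp add: cend_J GE_form_def Let_def J2_form_def cscale_def)
    moreover have "z = of_real \<Delta> * w" if "of_real (1 / \<Delta>) * z = w" for z w :: complex
      using that \<Delta>_pos by auto
    ultimately have "of_real P * (- X $ Inl 2) - of_real q * (of_real c * \<xi> $ Inl 2 - X $ Inl 1)
        = of_real \<Delta> * (\<i> * X $ Inr 2)" by blast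
    moreover have eq1: "of_real r * (X $ Inl 1 - of_real c * \<xi> $ Inl 2) = of_real q * X $ Inl 2"
      using u(3) by (simp add: csubspace_Sperp_iff algebra_simps)
    ultimately have "of_real \<Delta> * X $ Inl 2 = of_real \<Delta> * (- \<i> * of_real r * X $ Inr 2)"
      unfolding \<Delta>_def of_real_diff of_real_mult of_real_power by algebra
    moreover have "complex_of_real \<Delta> \<noteq> 0" using \<Delta>_pos by simp
    ultimately have x2: "X $ Inl 2 = - \<i> * of_real r * X $ Inr 2"
      using mult_left_cancel by blast
    have "of_real r * X $ Inl 1 = of_real r * (- \<i> * of_real (q + \<sigma> * c) * X $ Inr 2)"
      using eq1 x2 \<xi>(2) by (simp add: algebra_simps)
    moreover have "complex_of_real r \<noteq> 0" using r_pos by simp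
    ultimately have "X $ Inl 1 = - \<i> * of_real (q + \<sigma> * c) * X $ Inr 2"
      using mult_left_cancel by blast
    with m1 x2 show ?thesis by simp
  qed
  moreover have "X \<in> ?L" if "X \<in> ?R" for X
  proof -
    define \<xi> where "\<xi> = tm_vec 0 (- of_real \<sigma> * \<i> * X $ Inr 2)
        (of_real \<sigma> * \<i> * X $ Inl 1) (of_real \<sigma> * \<i> * X $ Inl 2)"
    have X: "X $ Inr 1 = 0" "X $ Inl 1 = - \<i> * of_real (q + \<sigma> * c) * X $ Inr 2"
      "X $ Inl 2 = - \<i> * of_real r * X $ Inr 2" using that by auto
    have "J2_form (X, \<xi>) = cscale (of_real \<sigma> * \<i>) (X, \<xi>)"
      using X(1) by (simp add: J2_iff \<xi>_def)
    moreover have "(X, \<xi>) \<in> csubspace Sperp"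
      using assms by (auto simp: csubspace_Sperp_iff \<xi>_def X algebra_simps)
    moreover have "cend J (X, \<xi>) = cscale \<i> (X, \<xi>)"
    proof -
      have k: "of_real (1 / \<Delta>) * z = w" if "z = of_real \<Delta> * w" for z w :: complex
        using that \<Delta>_pos by simp
      show ?thesis
        using assms
        unfolding cend_J GE_form_def Let_def cscale_def prod_eq_iff vec22_eq_iff fst_conv snd_conv
          tm_vec_nth vector_smult_component
        by (intro conjI k) (auto simp: J2_form_def \<xi>_def X \<Delta>_def D_def algebra_simps power2_eq_square)
    qed
    ultimately show ?thesis by (intro image_eqI[of _ _ "(X, \<xi>)"]) auto
  qed
  ultimately show ?thesis by blast
qed

lemma T12_eq:
  "fst ` (eigen_i J \<inter> eigen_i (A \<circ> J) \<inter> csubspace Sperp) =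
   {X. X $ Inr 1 = 0 \<and> X $ Inl 1 = - \<i> * of_real (q + c) * X $ Inr 2
      \<and> X $ Inl 2 = - \<i> * of_real r * X $ Inr 2}"
  using tangent_of_L1_L2[of 1] by (simp add: eigen_i_def cend_AJ)

lemma T1b2_eq:
  "fst ` (eigen_i J \<inter> gconj ` eigen_i (A \<circ> J) \<inter> csubspace Sperp) =
   {X. X $ Inr 1 = 0 \<and> X $ Inl 1 = - \<i> * of_real (q - c) * X $ Inr 2
      \<and> X $ Inl 2 = - \<i> * of_real r * X $ Inr 2}"
proof -
  have "gconj ` eigen_i (A \<circ> J) = {u. J2_form u = cscale (- \<i>) u}"
    using in_gconj_eigen_i[OF linear_compose[OF linear_J linear_A]] by (auto simp: cend_AJ)
  then show ?thesis using tangent_of_L1_L2[of "- 1"] by (simp add: eigen_i_def)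
qed

lemma tangent_Sperp: "X \<in> fst ` csubspace Sperp \<Longrightarrow> X $ Inr 1 = 0"
  by (auto simp: csubspace_Sperp_iff)

lemma T2_subset:
  assumes "X \<in> fst ` (eigen_i (A \<circ> J) \<inter> csubspace Sperp)"
  shows "X $ Inr 1 = 0" and "X $ Inl 1 = of_real (q / r) * X $ Inl 2 - \<i> * of_real c * X $ Inr 2"
proof -
  obtain \<xi> where u: "J2_form (X, \<xi>) = cscale \<i> (X, \<xi>)" "(X, \<xi>) \<in> csubspace Sperp"
    using assms by (auto simp: eigen_i_def cend_AJ)
  show "X $ Inr 1 = 0" using u(2) by (simp add: csubspace_Sperp_iff)
  have "X $ Inr 2 = \<i> * \<xi> $ Inl 2"
    using u(1) by (simp add: J2_form_def cscale_def prod_eq_iff vec22_eq_iff)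
  then have "\<xi> $ Inl 2 = - \<i> * X $ Inr 2" by (simp add: complex_eq_iff)
  then have "of_real r * X $ Inl 1 - of_real q * X $ Inl 2 = - \<i> * of_real (c * r) * X $ Inr 2"
    using u(2) by (simp add: csubspace_Sperp_iff)
  then show "X $ Inl 1 = of_real (q / r) * X $ Inl 2 - \<i> * of_real c * X $ Inr 2"
    using r_pos by (simp add: field_simps)
qed

end

lemma presents_value:
  assumes "presents B L" "(X, \<xi>) \<in> L" "Y \<in> fst ` L"
  shows "B X Y = ev \<xi> Y"
proof -
  have "L = {(X, \<xi>). X \<in> fst ` L \<and> (\<forall>Y\<in>fst ` L. ev \<xi> Y = B X Y)}"
    using assms(1) by (simp add: presents_def)
  then have "(X, \<xi>) \<in> {(X, \<xi>). X \<in> fst ` L \<and> (\<forall>Y\<in>fst ` L. ev \<xi> Y = B X Y)}"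
    using assms(2) by (rule subst)
  then have "X \<in> fst ` L \<and> (\<forall>Y\<in>fst ` L. ev \<xi> Y = B X Y)" unfolding mem_Collect_eq prod.case .
  then show ?thesis using assms(3) by metis
qed

definition omega_form :: "'a::comm_ring_1 ^ (2 + 2) \<Rightarrow> 'a ^ (2 + 2) \<Rightarrow> 'a" where
  "omega_form X Y = X $ Inr 1 * Y $ Inl 1 - Y $ Inr 1 * X $ Inl 1
     + X $ Inr 2 * Y $ Inl 2 - Y $ Inr 2 * X $ Inl 2"

lemma omega_eq: "omega = omega_form"
  by (intro ext) (simp add: omega_def omega_form_def sum_2 wedge_def ev_def sum_22 dmu_def dt_def axis_def)

lemma cbilin_omega_form: "cbilin omega_form = omega_form"
  by (intro ext)
    (simp add: cbilin_def omega_form_def rev_part_def imv_part_def complex_eq_iff algebra_simps)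

context toric_fibre begin

text \<open>The covector \<open>\<xi>\<close> with \<open>X + \<xi> \<in> L\<^sub>1\<close>: solving \<open>\<J>(X + \<xi>) = i (X + \<xi>)\<close> for \<open>\<xi>\<close> amounts to inverting
  \<open>C\<close>. If \<open>X\<close> has \<open>t\<close>-part \<open>x\<close> and \<open>\<mu>\<close>-part \<open>m\<close>, the two parts of \<open>\<xi>\<close> are \<open>C\<^sup>-\<^sup>1 (x + i H m)\<close> and
  \<open>C\<^sup>-\<^sup>1 (i adj(H) x - D m)\<close>. In particular \<open>E\<^sub>1\<close> is the whole complexified tangent space; this is
  where \<open>C\<^sub>1\<^sub>2 \<noteq> 0\<close> enters.\<close>

definition eps1_form :: "complex ^ (2 + 2) \<Rightarrow> complex ^ (2 + 2)" where
  "eps1_form X =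
     tm_vec (- (X $ Inl 2 + \<i> * (of_real q * X $ Inr 1 + of_real r * X $ Inr 2)) / of_real c)
       ((X $ Inl 1 + \<i> * (of_real P * X $ Inr 1 + of_real q * X $ Inr 2)) / of_real c)
       ((of_real D * X $ Inr 2 - \<i> * (of_real P * X $ Inl 2 - of_real q * X $ Inl 1)) / of_real c)
       ((\<i> * (of_real r * X $ Inl 1 - of_real q * X $ Inl 2) - of_real D * X $ Inr 1) / of_real c)"

lemma eps1_form_in_L1: "(X, eps1_form X) \<in> eigen_i J"
proof -
  have k: "of_real (1 / \<Delta>) * z = w" if "of_real c * z = of_real c * of_real \<Delta> * w" for z w :: complex
    using that \<Delta>_pos c_nonzero by simp
  show ?thesis
    unfolding eigen_i_def mem_Collect_eq cend_J GE_form_def Let_def cscale_def prod_eq_iff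
      vec22_eq_iff fst_conv snd_conv tm_vec_nth vector_smult_component
    using c_nonzero
    by (intro conjI k)
      (simp_all add: J2_form_def eps1_form_def field_simps,
       simp_all add: \<Delta>_def D_def algebra_simps power2_eq_square)
qed

lemma E1_eq: "fst ` eigen_i J = UNIV"
  using eps1_form_in_L1 by force

lemma eps1_eq: "presents e (eigen_i J) \<Longrightarrow> e X Y = ev (eps1_form X) Y"
  using presents_value[OF _ eps1_form_in_L1] E1_eq by blast

lemma eps2_eq:
  assumes "presents e (eigen_i (A \<circ> J))"
  shows "e X Y = - \<i> * omega_form X Y"
proof -
  define \<xi> where "\<xi> X = tm_vec (- \<i> * X $ Inr 1) (- \<i> * X $ Inr 2) (\<i> * X $ Inl 1) (\<i> * X $ Inl 2)"
    for X :: "complex ^ (2 + 2)"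
  have in_L2: "(X, \<xi> X) \<in> eigen_i (A \<circ> J)" for X
    by (simp add: eigen_i_def cend_AJ J2_form_def cscale_def prod_eq_iff vec22_eq_iff \<xi>_def)
  then have "Y \<in> fst ` eigen_i (A \<circ> J)" by force
  from presents_value[OF assms in_L2 this] show ?thesis
    by (simp add: \<xi>_def ev_def sum_22 omega_form_def algebra_simps)
qed

text \<open>The components of \<open>\<epsilon>\<^sub>1\<close> on \<open>\<partial>\<^sub>t \<and> \<partial>\<^sub>\<mu>\<close> form a multiple of the matrix \<open>C\<^sup>-\<^sup>1 H\<close>, which is traceless.
  This means \<open>\<epsilon>\<^sub>1 \<and> \<omega> = 0\<close>, and the identity below is its contraction with \<open>X\<^sub>0\<close>.\<close>

lemma eps1_wedge_omega:
  "wedge12 (ev (eps1_form (cv (- Dt 1)))) omega_form X Y W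
   = - wedge21 (\<lambda>X. ev (eps1_form X)) (\<lambda>X. X $ Inr 1) X Y W"
  using c_nonzero
  by (simp add: wedge12_def wedge21_def eps1_form_def omega_form_def ev_def sum_22 cv_def Dt_def axis_def)
    (simp add: field_simps)

end

section \<open>Constant two-forms and the flow of a coordinate field\<close>

lemma closed_two_form_constant:
  assumes "open M" "\<And>p u v. p \<in> M \<Longrightarrow> F p u v = B u v"
  shows "closed_two_form M F"
proof -
  have "frechet_derivative (\<lambda>q. F q u v) (at p) w = 0" if "p \<in> M" for p u v w
    using frechet_derivative_cong_open[OF assms(1) that, of "\<lambda>q. F q u v" "\<lambda>q. B u v"] assms(2)
    by (simp add: frechet_derivative_const)
  moreover have "smooth_on M (\<lambda>p. F p u v)" for u v
    by (rule smooth_on_cong[OF assms(1) smooth_on_const[of M "B u v"]]) (simp add: assms(2))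
  ultimately show ?thesis by (simp add: closed_two_form_def extd2_def)
qed

text \<open>Along a flow line \<open>\<phi> s p - s *\<^sub>R w\<close> has zero derivative. So the flow consists of translations,
  which preserve forms with constant coefficients.\<close>

lemma local_flow_constant_field:
  assumes "local_flow M (\<lambda>p. w) e U \<phi>" "s \<in> {-e<..<e}" "p \<in> U"
  shows "\<phi> s p = p + s *\<^sub>R w"
proof -
  have "((\<lambda>r. \<phi> r p - r *\<^sub>R w) has_derivative (\<lambda>_. 0)) (at r within {-e<..<e})"
    if "r \<in> {-e<..<e}" for r
  proof -
    have "((\<lambda>r. \<phi> r p) has_vector_derivative w) (at r)"
      using assms(1,3) that by (auto simp: local_flow_def)
    then have "((\<lambda>r. \<phi> r p - r *\<^sub>R w) has_derivative (\<lambda>t. t *\<^sub>R w - t *\<^sub>R w)) (at r)"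
      unfolding has_vector_derivative_def by (auto intro!: derivative_eq_intros)
    then show ?thesis by (simp add: has_derivative_at_withinI)
  qed
  from has_derivative_zero_constant[OF _ this] obtain d
    where d: "\<And>r. r \<in> {-e<..<e} \<Longrightarrow> \<phi> r p - r *\<^sub>R w = d" by auto
  have "0 < e" "\<phi> 0 p = p" using assms(1,3) by (auto simp: local_flow_def)
  then show ?thesis using d[of 0] d[OF assms(2)] by (simp add: algebra_simps)
qed

lemma flow_invariant_constant:
  assumes F: "\<And>p u v. p \<in> M \<Longrightarrow> F p u v = B u v"
  shows "flow_invariant M (\<lambda>p. w) F"
  unfolding flow_invariant_def
proof (intro allI impI ballI)
  fix e U \<phi> s p u v
  assume flow: "local_flow M (\<lambda>p. w) e U \<phi>" and s: "s \<in> {-e<..<e}" and p: "p \<in> U"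
  have U: "open U" "U \<subseteq> M" "\<phi> s p \<in> M" using flow s p by (auto simp: local_flow_def)
  have "((\<lambda>q. q + s *\<^sub>R w) has_derivative (\<lambda>v. v)) (at p)"
    by (auto intro!: derivative_eq_intros)
  then have "frechet_derivative (\<phi> s) (at p) v = v" for v
    using frechet_derivative_cong_open[OF U(1) p, of "\<phi> s" "\<lambda>q. q + s *\<^sub>R w"]
      local_flow_constant_field[OF flow s] frechet_derivative_eqI by metis
  then show "F (\<phi> s p) (frechet_derivative (\<phi> s) (at p) u) (frechet_derivative (\<phi> s) (at p) v) = F p u v"
    using F U p by auto
qed

section \<open>Toric structures in terms of the Hessian\<close>

lemma matrix_inv_2:
  fixes A :: "real ^ 2 ^ 2"
  assumes "\<delta> = A $ 1 $ 1 * A $ 2 $ 2 - A $ 1 $ 2 * A $ 2 $ 1" "\<delta> \<noteq> 0"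
  shows "matrix_inv A $ 1 $ 1 = A $ 2 $ 2 / \<delta>" "matrix_inv A $ 1 $ 2 = - A $ 1 $ 2 / \<delta>"
    "matrix_inv A $ 2 $ 1 = - A $ 2 $ 1 / \<delta>" "matrix_inv A $ 2 $ 2 = A $ 1 $ 1 / \<delta>"
proof -
  define B :: "real ^ 2 ^ 2" where
    "B = (\<chi> i j. (if i = j then A $ (if i = 1 then 2 else 1) $ (if i = 1 then 2 else 1) else - A $ i $ j) / \<delta>)"
  have B: "B $ 1 $ 1 = A $ 2 $ 2 / \<delta>" "B $ 1 $ 2 = - A $ 1 $ 2 / \<delta>"
    "B $ 2 $ 1 = - A $ 2 $ 1 / \<delta>" "B $ 2 $ 2 = A $ 1 $ 1 / \<delta>"
    by (simp_all add: B_def)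
  have "A ** B = mat 1"
    using assms(2) by (simp add: vec_eq_iff forall_2 matrix_matrix_mult_def sum_2 mat_def B field_simps)
      (simp add: assms(1) algebra_simps)
  moreover have "B ** A = mat 1"
    using assms(2) by (simp add: vec_eq_iff forall_2 matrix_matrix_mult_def sum_2 mat_def B field_simps)
      (simp add: assms(1) algebra_simps)
  ultimately have "invertible A" "A ** B = mat 1" by (auto simp: invertible_def)
  then have "matrix_inv A ** A = mat 1" "A ** B = mat 1"
    unfolding matrix_inv_def invertible_def by (metis (mono_tags, lifting) someI_ex)+
  then have "matrix_inv A = B"
    by (metis matrix_mul_assoc matrix_mul_lid matrix_mul_rid)
  then show "matrix_inv A $ 1 $ 1 = A $ 2 $ 2 / \<delta>" "matrix_inv A $ 1 $ 2 = - A $ 1 $ 2 / \<delta>"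
    "matrix_inv A $ 2 $ 1 = - A $ 2 $ 1 / \<delta>" "matrix_inv A $ 2 $ 2 = A $ 1 $ 1 / \<delta>"
    using B by simp_all
qed

lemma bounded_linear_mu: "bounded_linear mu"
  by (simp add: linear_conv_bounded_linear[symmetric])
    (rule linearI; simp add: mu_def vec_eq_iff)

lemma mu_axis: "mu (axis (Inl i) 1) = 0" "mu (axis (Inr i) 1) = axis i 1"
  by (simp_all add: mu_def vec_eq_iff axis_def)

lemma open_mu_image: "open M \<Longrightarrow> open (mu ` M)"
proof (rule open_surjective_linear_image)
  show "linear mu" using bounded_linear_mu by (rule bounded_linear.linear)
  show "surj mu"
  proof (rule surjI)
    show "mu (\<chi> k. case k of Inl i \<Rightarrow> 0 | Inr i \<Rightarrow> x $ i) = x" for x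
      by (simp add: mu_def vec_eq_iff)
  qed
qed

lemma pd_compose_mu:
  assumes "g differentiable (at (mu p))"
  shows "pd (Inl i) (\<lambda>p. g (mu p)) p = 0" "pd (Inr i) (\<lambda>p. g (mu p)) p = pd i g (mu p)"
proof -
  note D = frechet_derivative_eqI[OF has_derivative_compose_linear[OF bounded_linear_mu assms]]
  show "pd (Inl i) (\<lambda>p. g (mu p)) p = 0"
    by (simp add: pd_def D mu_axis linear_0[OF linear_frechet_derivative[OF assms]])
  show "pd (Inr i) (\<lambda>p. g (mu p)) p = pd i g (mu p)"
    by (simp add: pd_def D mu_axis)
qed

locale toric_kaehler =
  fixes M :: "(real ^ (2 + 2)) set" and \<tau> :: "real ^ 2 \<Rightarrow> real" and C :: "real ^ 2 ^ 2"
    and GE J :: "real ^ (2 + 2) \<Rightarrow> (2 + 2) gtm \<Rightarrow> (2 + 2) gtm"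
  assumes open_M: "open M"
    and smooth_\<tau>: "smooth_on (mu ` M) \<tau>"
    and hess_pos: "\<forall>x\<in>mu ` M. \<forall>v. v \<noteq> 0 \<longrightarrow> (\<Sum>i\<in>UNIV. \<Sum>j\<in>UNIV. hess \<tau> x $ i $ j * v $ i * v $ j) > 0"
    and C_skew: "\<forall>i j. C $ i $ j = - C $ j $ i"
    and C12: "C $ 1 $ 2 \<noteq> 0"
    and toric: "toric_structure M \<tau> C GE J"
begin

definition H11 where "H11 p = hess \<tau> (mu p) $ 1 $ 1"
definition H12 where "H12 p = hess \<tau> (mu p) $ 1 $ 2"
definition H22 where "H22 p = hess \<tau> (mu p) $ 2 $ 2"
abbreviation "c \<equiv> C $ 1 $ 2"

lemma smooth_hess: "smooth_on (mu ` M) (\<lambda>x. hess \<tau> x $ i $ j)"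
  using smooth_on_frechet_derivative[OF smooth_on_frechet_derivative[OF smooth_\<tau>]]
  by (simp add: hess_def pd_def[abs_def])

text \<open>Only the symmetry of the Hessian guarantees that \<open>C\<close> is exactly the skew part of \<open>\<Psi>\<close>, so that
  this skew part is constant.\<close>

lemma hess_symmetric: "x \<in> mu ` M \<Longrightarrow> hess \<tau> x $ 2 $ 1 = hess \<tau> x $ 1 $ 2"
  using second_derivative_symmetric[OF open_mu_image[OF open_M] _ smooth_\<tau>]
  by (simp add: hess_def pd_def[abs_def])

lemma hess_det_pos:
  assumes "x \<in> mu ` M"
  shows "hess \<tau> x $ 2 $ 2 > 0" "hess \<tau> x $ 1 $ 1 * hess \<tau> x $ 2 $ 2 - (hess \<tau> x $ 1 $ 2)\<^sup>2 > 0"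
proof -
  let ?P = "hess \<tau> x $ 1 $ 1" and ?q = "hess \<tau> x $ 1 $ 2" and ?r = "hess \<tau> x $ 2 $ 2"
  have quad: "?P * u * u + ?q * u * v + ?q * v * u + ?r * v * v > 0" if "u \<noteq> 0 \<or> v \<noteq> 0" for u v
  proof -
    define w :: "real ^ 2" where "w = (\<chi> i. if i = 1 then u else v)"
    have w: "w $ 1 = u" "w $ 2 = v" by (simp_all add: w_def)
    then have "w \<noteq> 0" using that by auto
    then have "(\<Sum>i\<in>UNIV. \<Sum>j\<in>UNIV. hess \<tau> x $ i $ j * w $ i * w $ j) > 0"
      using hess_pos assms by blast
    then show ?thesis by (simp add: sum_2 w hess_symmetric[OF assms] add.assoc)
  qed
  show r: "?r > 0" using quad[of 0 1] by simp
  \<comment> \<open>the quadratic form of the Hessian takes at \<open>(r, - q)\<close> the value \<open>r\<close> times its determinant\<close>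
  have "?r * (?P * ?r - ?q\<^sup>2) > 0"
    using quad[of ?r "- ?q"] r by (simp add: algebra_simps power2_eq_square)
  then show "?P * ?r - ?q\<^sup>2 > 0" using r by (simp add: zero_less_mult_iff)
qed

lemma H_pos: "p \<in> M \<Longrightarrow> H22 p > 0" "p \<in> M \<Longrightarrow> H11 p * H22 p - (H12 p)\<^sup>2 > 0"
  using hess_det_pos[of "mu p"] by (simp_all add: H11_def H12_def H22_def)

lemma C_entries: "C $ 1 $ 1 = 0" "C $ 2 $ 2 = 0" "C $ 2 $ 1 = - c"
proof -
  have skew: "C $ i $ j = - C $ j $ i" for i j using C_skew by blast
  show "C $ 1 $ 1 = 0" "C $ 2 $ 2 = 0" using skew[of 1 1] skew[of 2 2] by auto
  show "C $ 2 $ 1 = - c" by (rule skew)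
qed

lemma Psi_entries:
  assumes "p \<in> M"
  shows "Psi \<tau> C (mu p) $ 1 $ 1 = H11 p" "Psi \<tau> C (mu p) $ 2 $ 2 = H22 p"
    "Psi \<tau> C (mu p) $ 1 $ 2 = H12 p + c" "Psi \<tau> C (mu p) $ 2 $ 1 = H12 p - c"
  using hess_symmetric[of "mu p"] assms
  by (simp_all add: Psi_def H11_def H12_def H22_def C_entries)

lemma structure_maps:
  assumes "p \<in> M"
  shows "J_plus \<tau> C p = toric_J (H11 p) (H12 p) (H22 p) c"
    and "J_minus \<tau> C p = toric_J (H11 p) (H12 p) (H22 p) (- c)"
    and "g_map \<tau> C p = toric_g (H11 p) (H12 p) (H22 p) c"
    and "b_map \<tau> C p = toric_b (H11 p) (H12 p) (H22 p) c"
proof -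
  define \<delta> where "\<delta> = H11 p * H22 p - (H12 p)\<^sup>2 + c\<^sup>2"
  have \<delta>: "\<delta> > 0" using H_pos[OF assms] by (simp add: \<delta>_def add_pos_nonneg)
  have det: "\<delta> = Psi \<tau> C (mu p) $ 1 $ 1 * Psi \<tau> C (mu p) $ 2 $ 2 - Psi \<tau> C (mu p) $ 1 $ 2 * Psi \<tau> C (mu p) $ 2 $ 1"
    by (simp add: \<delta>_def Psi_entries[OF assms] algebra_simps power2_eq_square)
  note inv = matrix_inv_2[OF det less_imp_neq[OF \<delta>, symmetric]]
  show plus: "J_plus \<tau> C p = toric_J (H11 p) (H12 p) (H22 p) c"
    by (intro ext)
      (simp add: J_plus_def toric_J_def vec22_eq_iff sum_2 inv Psi_entries[OF assms] ev_def sum_22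
        Dt_def Dmu_def dt_def dmu_def axis_def flip: \<delta>_def; simp add: add_divide_distrib diff_divide_distrib algebra_simps)
  show minus: "J_minus \<tau> C p = toric_J (H11 p) (H12 p) (H22 p) (- c)"
    by (intro ext)
      (simp add: J_minus_def toric_J_def vec22_eq_iff sum_2 inv Psi_entries[OF assms] ev_def sum_22
        Dt_def Dmu_def dt_def dmu_def axis_def flip: \<delta>_def; simp add: add_divide_distrib diff_divide_distrib algebra_simps)
  have omega_map: "omega_map X = tm_vec (X $ Inr 1) (X $ Inr 2) (- (X $ Inl 1)) (- (X $ Inl 2))" for X
    by (simp add: omega_map_def omega_eq omega_form_def vec22_eq_iff axis_def)
  show "g_map \<tau> C p = toric_g (H11 p) (H12 p) (H22 p) c"
    by (intro ext)
      (simp add: g_map_def plus minus omega_map toric_J_def toric_g_def vec22_eq_iff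
        flip: \<delta>_def; simp add: add_divide_distrib diff_divide_distrib algebra_simps)
  show "b_map \<tau> C p = toric_b (H11 p) (H12 p) (H22 p) c"
    by (intro ext)
      (simp add: b_map_def plus minus omega_map toric_J_def toric_b_def vec22_eq_iff
        flip: \<delta>_def; simp add: add_divide_distrib diff_divide_distrib algebra_simps)
qed

lemma fibre:
  assumes "p \<in> M"
  shows "toric_fibre (H11 p) (H12 p) (H22 p) c (GE p) (J p)"
proof -
  have "let g = g_map \<tau> C p; b = b_map \<tau> C p; Jp = J_plus \<tau> C p; Jm = J_minus \<tau> C p in
          linear (GE p) \<and> linear (J p) \<and>
          (\<forall>X. GE p (X, b X + g X) = (X, b X + g X) \<and>
               GE p (X, b X - g X) = - (X, b X - g X) \<and>
               J p (X, b X + g X) = (Jp X, b (Jp X) + g (Jp X)) \<and>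
               J p (X, b X - g X) = (Jm X, b (Jm X) - g (Jm X)))"
    using toric assms unfolding toric_structure_def by blast
  note * = this[unfolded Let_def structure_maps[OF assms]]
  show ?thesis
    using * H_pos[OF assms] C12 unfolding toric_fibre_def by blast
qed

end

section \<open>The twist data on a toric structure\<close>

text \<open>The assumptions are the consequences of the explicit formulas for \<open>a\<close>, \<open>h\<close>, \<open>f\<close> and \<open>F\<close> that
  the five conditions need: \<open>F\<close> is the multiple \<open>lambda0\<close> of \<open>\<omega>\<close>, the product \<open>a h\<^sup>2\<close> is constant, and
  \<open>f\<^sup>2\<close> is a function of \<open>\<mu>\<^sup>1\<close> tied to the ratio \<open>s = H\<^sub>1\<^sub>2 / H\<^sub>2\<^sub>2\<close>.\<close>

locale toric_kk = toric_kaehler M \<tau> C GE J + kk_data M GE J "\<lambda>p. - Dt 1" F a f h eps1 eps2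
  for M :: "(real ^ (2 + 2)) set" and \<tau> :: "real ^ 2 \<Rightarrow> real" and C :: "real ^ 2 ^ 2"
    and GE J :: "real ^ (2 + 2) \<Rightarrow> (2 + 2) gtm \<Rightarrow> (2 + 2) gtm"
    and F :: "real ^ (2 + 2) \<Rightarrow> real ^ (2 + 2) \<Rightarrow> real ^ (2 + 2) \<Rightarrow> real"
    and a f h :: "real ^ (2 + 2) \<Rightarrow> real"
    and eps1 eps2 :: "real ^ (2 + 2) \<Rightarrow> complex ^ (2 + 2) \<Rightarrow> complex ^ (2 + 2) \<Rightarrow> complex" +
  fixes k0 lambda0 :: real
  assumes smooth_f: "smooth_on M f" and smooth_h: "smooth_on M h"
    and eps1: "\<And>p. p \<in> M \<Longrightarrow> presents (eps1 p) (L1 p)"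
    and eps2: "\<And>p. p \<in> M \<Longrightarrow> presents (eps2 p) (L2 p)"
    and F_eq: "\<And>p. p \<in> M \<Longrightarrow> F p = (\<lambda>X Y. lambda0 * omega_form X Y)"
    and dh_eq: "\<And>p v. p \<in> M \<Longrightarrow> frechet_derivative h (at p) v = lambda0 * h p / (2 * a p) * v $ Inr 1"
    and ah2: "\<And>p. p \<in> M \<Longrightarrow> a p * (h p)\<^sup>2 = k0" and h_nonzero: "\<And>p. p \<in> M \<Longrightarrow> h p \<noteq> 0"
    and a_nonzero: "\<And>p. p \<in> M \<Longrightarrow> a p \<noteq> 0"
    and f_nonzero: "\<And>p. p \<in> M \<Longrightarrow> f p \<noteq> 0" and f2_neq_1: "\<And>p. p \<in> M \<Longrightarrow> (f p)\<^sup>2 \<noteq> 1"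
    and f2_coordinate: "\<exists>\<Phi>. \<forall>p\<in>M. (f p)\<^sup>2 = \<Phi> (p $ Inr 1)"
    and f2_eq: "\<And>p. p \<in> M \<Longrightarrow>
      a p * ((f p)\<^sup>2 - 1) * pd 2 (Psi_ratio \<tau> C) (mu p) = - lambda0 * ((f p)\<^sup>2 + 1)"
begin

text \<open>\<open>\<rho>\<close> is \<open>2 G(X\<^sub>0, X\<^sub>0)\<close>. Together with \<open>s\<close> it determines the tangent part
  \<open>- c \<rho> (s \<partial>/\<partial>t\<^sup>1 + \<partial>/\<partial>t\<^sup>2)\<close> of \<open>\<J>\<^sub>3X\<^sub>0\<close>.\<close>

definition \<rho> :: "real ^ (2 + 2) \<Rightarrow> real" where
  "\<rho> p = H22 p / (H11 p * H22 p - (H12 p)\<^sup>2)"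

definition s :: "real ^ (2 + 2) \<Rightarrow> real" where "s p = H12 p / H22 p"

abbreviation s2 :: "real ^ (2 + 2) \<Rightarrow> real" where "s2 p \<equiv> pd (Inr 2) s p"

lemma \<rho>_pos: "p \<in> M \<Longrightarrow> \<rho> p > 0"
  using H_pos[of p] by (simp add: \<rho>_def)

text \<open>Basic for the torus action generated by the \<open>\<partial>/\<partial>t\<^sup>i\<close>; all coefficients of the structure are of
  this kind.\<close>

definition basic :: "(real ^ (2 + 2) \<Rightarrow> real) \<Rightarrow> bool" where
  "basic \<psi> \<longleftrightarrow> smooth_on M \<psi> \<and> (\<forall>p\<in>M. \<forall>i. pd (Inl i) \<psi> p = 0)"

lemma basic_mu:
  assumes "smooth_on (mu ` M) \<psi>"
  shows "basic (\<lambda>p. \<psi> (mu p))"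
  unfolding basic_def
  using smooth_on_compose_linear[OF open_M bounded_linear_mu assms]
    pd_compose_mu(1) smooth_on_differentiable[OF assms] by blast

lemma smooth_ratio:
  "smooth_on (mu ` M) (\<lambda>x. hess \<tau> x $ 1 $ 2 / hess \<tau> x $ 2 $ 2)"
  "smooth_on (mu ` M) (\<lambda>x. hess \<tau> x $ 2 $ 2 / (hess \<tau> x $ 1 $ 1 * hess \<tau> x $ 2 $ 2 - (hess \<tau> x $ 1 $ 2)\<^sup>2))"
  unfolding power2_eq_square using hess_det_pos
  by (intro smooth_on_divide smooth_on_diff smooth_on_mult smooth_hess open_mu_image open_M;
      force simp: power2_eq_square)+

lemma basic_H: "basic H12" "basic H22" "basic s" "basic \<rho>"
  using smooth_hess[THEN basic_mu] smooth_ratio[THEN basic_mu]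
  by (simp_all add: H11_def[abs_def] H12_def[abs_def] H22_def[abs_def] s_def[abs_def] \<rho>_def[abs_def])

lemma basic_differentiable: "basic \<psi> \<Longrightarrow> p \<in> M \<Longrightarrow> \<psi> differentiable (at p)"
  by (auto simp: basic_def intro: smooth_on_differentiable)

lemma pd_ratio: "p \<in> M \<Longrightarrow> pd 2 (Psi_ratio \<tau> C) (mu p) = s2 p"
proof -
  assume p: "p \<in> M"
  have "Psi_ratio \<tau> C x = hess \<tau> x $ 1 $ 2 / hess \<tau> x $ 2 $ 2" if "x \<in> mu ` M" for x
    using hess_symmetric[OF that] by (simp add: Psi_ratio_def Psi_def C_entries)
  then have "frechet_derivative (Psi_ratio \<tau> C) (at (mu p)) =
      frechet_derivative (\<lambda>x. hess \<tau> x $ 1 $ 2 / hess \<tau> x $ 2 $ 2) (at (mu p))"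
    using p by (intro frechet_derivative_cong_open[OF open_mu_image[OF open_M]]) auto
  moreover have "pd (Inr 2) s p = pd 2 (\<lambda>x. hess \<tau> x $ 1 $ 2 / hess \<tau> x $ 2 $ 2) (mu p)"
    unfolding s_def[abs_def] H12_def H22_def
    using p by (intro pd_compose_mu smooth_on_differentiable[OF smooth_ratio(1)]) auto
  ultimately show ?thesis by (simp add: pd_def)
qed

lemma s2_eq: "p \<in> M \<Longrightarrow> s2 p = - lambda0 * ((f p)\<^sup>2 + 1) / (a p * ((f p)\<^sup>2 - 1))"
  using f2_eq[of p] a_nonzero[of p] f2_neq_1[of p] by (simp add: pd_ratio field_simps)

lemma basic_derivative_vertical:
  assumes "basic \<psi>" "p \<in> M" "z $ Inr 1 = 0" "z $ Inr 2 = 0"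
  shows "frechet_derivative \<psi> (at p) z = 0"
  using assms by (simp add: frechet_derivative_expand[OF basic_differentiable[OF assms(1,2)]] sum_22
      basic_def flip: pd_def)

lemma basic_cdir:
  assumes "basic \<psi>" "p \<in> M" "X $ Inr 1 = 0"
  shows "cdir X (\<lambda>q. of_real (\<psi> q)) p = of_real (pd (Inr 2) \<psi> p) * X $ Inr 2"
  using assms by (simp add: cdir_of_real[OF basic_differentiable[OF assms(1,2)]] ev_def sum_22 cv_def
      diff0_def basic_def)

lemma basic_mult:
  assumes "basic \<psi>" "basic \<kappa>"
  shows "basic (\<lambda>p. \<psi> p * \<kappa> p)"
    and "p \<in> M \<Longrightarrow> pd k (\<lambda>p. \<psi> p * \<kappa> p) p = \<psi> p * pd k \<kappa> p + pd k \<psi> p * \<kappa> p"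
proof -
  show pd: "pd k (\<lambda>p. \<psi> p * \<kappa> p) p = \<psi> p * pd k \<kappa> p + pd k \<psi> p * \<kappa> p" if "p \<in> M" for k p
    unfolding pd_def using assms that
    by (intro frechet_derivative_eqI[OF has_derivative_mult] has_frechet_derivative basic_differentiable)
  show "basic (\<lambda>p. \<psi> p * \<kappa> p)"
    using assms by (auto simp: basic_def pd intro: smooth_on_mult[OF open_M])
qed

lemma basic_const: "basic (\<lambda>p. d)" "pd k (\<lambda>p. d) p = 0"
  by (simp_all add: basic_def smooth_on_const pd_def frechet_derivative_const)


subsection \<open>The spaces and tensors attached to the structure\<close>

lemma SC_eq: "SC p = csubspace (toric_fibre.Sperp (GE p) (J p))" if "p \<in> M"
  by (simp add: SC_def S_def toric_fibre.Sperp_def[OF fibre[OF that]] gX0_def J3_def J2_def)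

lemma orth_S_eq: "orth (S p) = toric_fibre.Sperp (GE p) (J p)" if "p \<in> M"
  by (simp add: S_def toric_fibre.Sperp_def[OF fibre[OF that]] gX0_def J3_def J2_def)

lemma T12_eq: "p \<in> M \<Longrightarrow> T12 p =
    {X. X $ Inr 1 = 0 \<and> X $ Inl 1 = - \<i> * of_real (H12 p + c) * X $ Inr 2
      \<and> X $ Inl 2 = - \<i> * of_real (H22 p) * X $ Inr 2}"
  using toric_fibre.T12_eq[OF fibre] by (simp add: T12_def L1_def L2_def J2_def SC_eq)

lemma T1b2_eq: "p \<in> M \<Longrightarrow> T1b2 p =
    {X. X $ Inr 1 = 0 \<and> X $ Inl 1 = - \<i> * of_real (H12 p - c) * X $ Inr 2
      \<and> X $ Inl 2 = - \<i> * of_real (H22 p) * X $ Inr 2}"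
  using toric_fibre.T1b2_eq[OF fibre] by (simp add: T1b2_def L1_def L2_def J2_def SC_eq)

lemma T2_imp:
  assumes "p \<in> M" "X \<in> T2 p"
  shows "X $ Inr 1 = 0" and "X $ Inl 1 = of_real (s p) * X $ Inl 2 - \<i> * of_real c * X $ Inr 2"
  using toric_fibre.T2_subset[OF fibre[OF assms(1)]] assms
  by (simp_all add: T2_def L2_def J2_def SC_eq s_def)

lemma Tb12_imp: "p \<in> M \<Longrightarrow> X \<in> Tb12 p \<Longrightarrow> X $ Inr 1 = 0"
  using toric_fibre.tangent_Sperp[OF fibre[of p], of X] by (auto simp: Tb12_def SC_eq)

lemma E1_eq: "p \<in> M \<Longrightarrow> E1 p = UNIV"
  using toric_fibre.E1_eq[OF fibre] by (simp add: E1_def L1_def)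

lemma eps2_eq: "p \<in> M \<Longrightarrow> eps2 p X Y = - \<i> * omega_form X Y"
  using toric_fibre.eps2_eq[OF fibre, of p "eps2 p"] eps2[of p] by (simp add: L2_def J2_def)

lemma J3_gX0:
  assumes "p \<in> M"
  shows "J3 p (gX0 p) =
    (tm_vec (- c * \<rho> p * s p) (- c * \<rho> p) 0 0, tm_vec (\<rho> p) (- \<rho> p * s p) 0 0)"
proof -
  have "H22 p * s p = H12 p" using H_pos(1)[OF assms] by (simp add: s_def)
  then show ?thesis
    using toric_fibre.J3_gX[OF fibre[OF assms]]
    by (simp add: J3_def J2_def gX0_def toric_fibre.\<Delta>_def[OF fibre[OF assms]] \<rho>_def mult.assoc)
qed

lemma GX0_eq: "p \<in> M \<Longrightarrow> GX0 p = \<rho> p / 2"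
  using toric_fibre.G_gX[OF fibre[of p]]
  by (simp add: GX0_def gX0_def \<rho>_def toric_fibre.\<Delta>_def[OF fibre])

lemma J2_gX0: "p \<in> M \<Longrightarrow> J2 p (gX0 p) = (0, tm_vec 0 0 1 0)"
  using toric_fibre.J2_gX[OF fibre[of p]] by (simp add: J2_def gX0_def)

lemma J_gX0:
  assumes "p \<in> M"
  shows "J p (gX0 p) =
    (tm_vec 0 0 (\<rho> p) (- \<rho> p * s p), tm_vec 0 0 (- c * \<rho> p * s p) (- c * \<rho> p))"
proof -
  have "H22 p * s p = H12 p" using H_pos(1)[OF assms] by (simp add: s_def)
  then show ?thesis
    using toric_fibre.J_gX[OF fibre[OF assms]]
    by (simp add: gX0_def toric_fibre.\<Delta>_def[OF fibre[OF assms]] \<rho>_def mult.assoc)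
qed

lemma fst_vf:
  assumes "p \<in> M"
  shows "fst (vf p) = tm_vec (- 1 + of_real (c * \<rho> p * s p / (f p)\<^sup>2)) (of_real (c * \<rho> p / (f p)\<^sup>2))
    (- \<i> * of_real (\<rho> p)) (\<i> * of_real (\<rho> p * s p))"
  unfolding vf_def J3_gX0[OF assms] J2_gX0[OF assms] J_gX0[OF assms] unfolding gX0_def
  by (simp add: vec22_eq_iff cg_def cscale_def cv_def Dt_def axis_def)

lemma fst_vif:
  assumes "p \<in> M"
  shows "fst (vif p) = tm_vec (- 1 - of_real (c * \<rho> p * s p / (f p)\<^sup>2)) (- of_real (c * \<rho> p / (f p)\<^sup>2))
    (- \<i> * of_real (\<rho> p)) (\<i> * of_real (\<rho> p * s p))"
  unfolding vif_def J3_gX0[OF assms] J2_gX0[OF assms] J_gX0[OF assms] unfolding gX0_def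
  by (simp add: vec22_eq_iff cg_def cscale_def cv_def Dt_def axis_def)

lemma cbilin_F: "p \<in> M \<Longrightarrow> cbilin (F p) X Y = of_real lambda0 * omega_form X Y"
  by (simp add: F_eq cbilin_scale cbilin_omega_form)

lemma ev_dh: "p \<in> M \<Longrightarrow> ev (dh p) X = of_real (lambda0 * h p / (2 * a p)) * X $ Inr 1"
  by (simp add: dh_def ev_def cv_def diff0_def pd_def dh_eq sum_22 axis_def)

text \<open>The factor \<open>\<bar>f\<^sup>2 - 1\<bar> / f\<^sup>2\<close> only depends on \<open>\<mu>\<^sup>1\<close>, so that on vectors without
  \<open>\<mu>\<^sup>1\<close>-component \<open>\<alpha>\<close> is the logarithmic derivative of \<open>G(X\<^sub>0, X\<^sub>0)\<close>.\<close>

lemma f2_derivative: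
  assumes "p \<in> M" "v $ Inr 1 = 0" "\<phi> differentiable (at p)"
    and "\<And>q. q \<in> M \<Longrightarrow> \<phi> q = \<kappa> ((f q)\<^sup>2)"
  shows "frechet_derivative \<phi> (at p) v = 0"
proof -
  obtain \<Phi> where "\<And>q. q \<in> M \<Longrightarrow> (f q)\<^sup>2 = \<Phi> (q $ Inr 1)" using f2_coordinate by blast
  then show ?thesis
    using assms
    by (intro frechet_derivative_one_coordinate[OF open_M, where \<Phi> = "\<lambda>m. \<kappa> (\<Phi> m)" and k = "Inr 1"]) auto
qed

lemma f2_differentiable: "p \<in> M \<Longrightarrow> (\<lambda>q. (f q)\<^sup>2) differentiable (at p)"
  using smooth_on_differentiable[OF smooth_f, of p] by simp

lemma differentiable_ln:
  fixes g :: "real ^ (2 + 2) \<Rightarrow> real"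
  shows "g differentiable (at p) \<Longrightarrow> g p > 0 \<Longrightarrow> (\<lambda>q. ln (g q)) differentiable (at p)"
  unfolding differentiable_def using has_derivative_ln by blast

lemma alpha_ev:
  assumes p: "p \<in> M" and X: "X $ Inr 1 = 0"
  shows "ev (cv (alpha p)) X = of_real (pd (Inr 2) \<rho> p / \<rho> p) * X $ Inr 2"
proof -
  \<comment> \<open>the square removes the absolute value, so that \<open>\<phi>\<close> is visibly differentiable\<close>
  define \<phi> where "\<phi> q = ln ((2 * ((f q)\<^sup>2 - 1) / (f q)\<^sup>2)\<^sup>2) / 2" for q
  have fp: "(f p)\<^sup>2 - 1 \<noteq> 0" "(f p)\<^sup>2 \<noteq> 0" using f2_neq_1[OF p] f_nonzero[OF p] by auto
  have split: "ln (\<bar>(f q)\<^sup>2 - 1\<bar> / ((f q)\<^sup>2 * GX0 q)) = \<phi> q - ln (\<rho> q)" if "q \<in> M" for q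
  proof -
    have fq: "\<bar>(f q)\<^sup>2 - 1\<bar> > 0" "(f q)\<^sup>2 > 0" using f2_neq_1[OF that] f_nonzero[OF that] by auto
    have "\<bar>(f q)\<^sup>2 - 1\<bar> / ((f q)\<^sup>2 * GX0 q) = (2 * \<bar>(f q)\<^sup>2 - 1\<bar> / (f q)\<^sup>2) / \<rho> q"
      by (simp add: GX0_eq[OF that])
    also have "ln \<dots> = ln (2 * \<bar>(f q)\<^sup>2 - 1\<bar> / (f q)\<^sup>2) - ln (\<rho> q)"
      using fq \<rho>_pos[OF that] by (intro ln_divide_pos) auto
    also have "ln (2 * \<bar>(f q)\<^sup>2 - 1\<bar> / (f q)\<^sup>2) = ln ((2 * \<bar>(f q)\<^sup>2 - 1\<bar> / (f q)\<^sup>2)\<^sup>2) / 2"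
      using fq by (subst ln_realpow) auto
    also have "(2 * \<bar>(f q)\<^sup>2 - 1\<bar> / (f q)\<^sup>2)\<^sup>2 = (2 * ((f q)\<^sup>2 - 1) / (f q)\<^sup>2)\<^sup>2"
      by (simp only: power_divide power_mult_distrib power2_abs)
    finally show ?thesis by (simp add: \<phi>_def)
  qed
  have "(\<lambda>q. (2 * ((f q)\<^sup>2 - 1) / (f q)\<^sup>2)\<^sup>2) differentiable (at p)"
    using smooth_on_differentiable[OF smooth_f p] fp(2)
    by (intro differentiable_power differentiable_divide differentiable_mult differentiable_diff) auto
  then have d\<phi>: "\<phi> differentiable (at p)"
    unfolding \<phi>_def[abs_def] using fp by (intro differentiable_divide differentiable_ln) auto
  have "frechet_derivative \<phi> (at p) v = 0" if "v $ Inr 1 = 0" for v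
    by (rule f2_derivative[OF p that d\<phi>]) (simp only: \<phi>_def)
  then have \<phi>0: "pd (Inl i) \<phi> p = 0" "pd (Inr 2) \<phi> p = 0" for i
    by (simp_all add: pd_def axis_def)
  have "((\<lambda>q. ln (\<rho> q)) has_derivative (\<lambda>v. frechet_derivative \<rho> (at p) v / \<rho> p)) (at p)"
    using has_derivative_ln[OF \<rho>_pos[OF p] has_frechet_derivative[OF basic_differentiable[OF basic_H(4) p]]]
    by (simp add: divide_inverse mult.commute)
  then have "((\<lambda>q. \<phi> q - ln (\<rho> q)) has_derivative
      (\<lambda>v. frechet_derivative \<phi> (at p) v - frechet_derivative \<rho> (at p) v / \<rho> p)) (at p)"
    by (intro has_derivative_diff has_frechet_derivative[OF d\<phi>])
  note D = frechet_derivative_eqI[OF this]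
  have "alpha p $ k = pd k \<rho> p / \<rho> p - pd k \<phi> p" for k
    using frechet_derivative_cong_open[OF open_M p split] by (simp add: alpha_def diff0_def pd_def D)
  then show ?thesis
    using basic_H(4) p X by (simp add: ev_def sum_22 cv_def \<phi>0 basic_def)
qed

text \<open>\<open>z\<close> is \<open>Z\<close> before complexification. It is tangent to the torus orbits, so it annihilates all
  basic functions.\<close>

definition z :: "real ^ (2 + 2) \<Rightarrow> real ^ (2 + 2)" where
  "z p = tm_vec (- c * \<rho> p * s p) (- c * \<rho> p) 0 0"

lemma Z_eq: "p \<in> M \<Longrightarrow> Z p = cv (z p)"
  by (simp add: Z_def J3_gX0 z_def)

lemma differentiable_nth:
  fixes X :: "real ^ (2 + 2) \<Rightarrow> complex ^ (2 + 2)"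
  assumes "X differentiable (at p)"
  shows "(\<lambda>q. X q $ k) differentiable (at p)"
    and "frechet_derivative (\<lambda>q. X q $ k) (at p) v = frechet_derivative X (at p) v $ k"
proof -
  have D: "((\<lambda>q. X q $ k) has_derivative (\<lambda>v. frechet_derivative X (at p) v $ k)) (at p)"
    by (rule bounded_linear.has_derivative[OF bounded_linear_vec_nth has_frechet_derivative[OF assms]])
  then show "(\<lambda>q. X q $ k) differentiable (at p)" by (auto simp: differentiable_def)
  show "frechet_derivative (\<lambda>q. X q $ k) (at p) v = frechet_derivative X (at p) v $ k"
    by (rule frechet_derivative_eqI[OF D])
qed

text \<open>In \<open>[Z, X] + \<alpha>(X) Z\<close> the term \<open>\<alpha>(X) Z\<close> cancels the derivative of \<open>\<rho>\<close> that \<open>[Z, X]\<close> contains.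
  What remains, besides the derivative of \<open>X\<close> along \<open>Z\<close>, comes from the derivative of \<open>s\<close>.\<close>

lemma DZ_eq:
  assumes p: "p \<in> M" and X: "X differentiable (at p)" "X p $ Inr 1 = 0"
  shows "DZ X p = frechet_derivative X (at p) (z p)
    + tm_vec (of_real (c * \<rho> p * s2 p) * X p $ Inr 2) 0 0 0"
proof -
  have X_part: "cdir (Z p) (\<lambda>q. X q $ k) p = frechet_derivative X (at p) (z p) $ k" for k
    using differentiable_nth[OF X(1)] by (simp add: Z_eq[OF p] cdir_cv)
  have Z_part: "cdir (X p) (\<lambda>q. Z q $ k) p = cdir (X p) (\<lambda>q. of_real (z q $ k)) p" for k
    by (rule cdir_cong_open[OF open_M p]) (simp add: Z_eq cv_def)
  have basics: "basic (\<lambda>q. - c * (\<rho> q * s q))" "basic (\<lambda>q. - c * \<rho> q)"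
    by (intro basic_mult(1) basic_const(1) basic_H)+
  have "pd (Inr 2) (\<lambda>q. - c * (\<rho> q * s q)) p = - c * (\<rho> p * s2 p + pd (Inr 2) \<rho> p * s p)"
    unfolding basic_mult(2)[OF basic_const(1) basic_mult(1)[OF basic_H(4,3)] p]
      basic_mult(2)[OF basic_H(4,3) p] basic_const(2) by simp
  moreover have "(\<lambda>q. complex_of_real (z q $ Inl 1)) = (\<lambda>q. of_real (- c * (\<rho> q * s q)))"
    by (simp add: z_def mult.assoc)
  ultimately have Z1: "cdir (X p) (\<lambda>q. of_real (z q $ Inl 1)) p
      = of_real (- c * (\<rho> p * s2 p + pd (Inr 2) \<rho> p * s p)) * X p $ Inr 2"
    using basic_cdir[OF basics(1) p X(2)] by (simp only:)
  have "pd (Inr 2) (\<lambda>q. - c * \<rho> q) p = - c * pd (Inr 2) \<rho> p"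
    unfolding basic_mult(2)[OF basic_const(1) basic_H(4) p] basic_const(2) by simp
  moreover have "(\<lambda>q. complex_of_real (z q $ Inl 2)) = (\<lambda>q. of_real (- c * \<rho> q))"
    by (simp add: z_def)
  ultimately have Z2: "cdir (X p) (\<lambda>q. of_real (z q $ Inl 2)) p
      = of_real (- c * pd (Inr 2) \<rho> p) * X p $ Inr 2"
    using basic_cdir[OF basics(2) p X(2)] by (simp only:)
  have Z3: "cdir (X p) (\<lambda>q. of_real (z q $ Inr i)) p = 0" for i
  proof -
    have "z q $ Inr i = 0" for q using exhaust_2[of i] by (auto simp: z_def)
    then show ?thesis by (simp add: cdir_const)
  qed
  have \<alpha>: "of_real (pd (Inr 2) \<rho> p / \<rho> p) * w * of_real (z p $ Inl 1) = of_real (- c * pd (Inr 2) \<rho> p * s p) * w"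
    "of_real (pd (Inr 2) \<rho> p / \<rho> p) * w * of_real (z p $ Inl 2) = of_real (- c * pd (Inr 2) \<rho> p) * w"
    for w :: complex
  proof -
    have assoc: "of_real x * w * of_real y = of_real v * w" if "x * y = v" for x y v :: real
      unfolding that[symmetric] of_real_mult by (simp add: mult_ac)
    have "pd (Inr 2) \<rho> p / \<rho> p * z p $ Inl 1 = - c * pd (Inr 2) \<rho> p * s p"
      "pd (Inr 2) \<rho> p / \<rho> p * z p $ Inl 2 = - c * pd (Inr 2) \<rho> p"
      using \<rho>_pos[OF p] by (simp_all add: z_def)
    then show "of_real (pd (Inr 2) \<rho> p / \<rho> p) * w * of_real (z p $ Inl 1) = of_real (- c * pd (Inr 2) \<rho> p * s p) * w"
      "of_real (pd (Inr 2) \<rho> p / \<rho> p) * w * of_real (z p $ Inl 2) = of_real (- c * pd (Inr 2) \<rho> p) * w"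
      using assoc by blast+
  qed
  have "DZ X p $ k = frechet_derivative X (at p) (z p) $ k - cdir (X p) (\<lambda>q. of_real (z q $ k)) p
      + of_real (pd (Inr 2) \<rho> p / \<rho> p) * X p $ Inr 2 * of_real (z p $ k)" for k
    unfolding DZ_def lie_bracket_def alpha_ev[OF p X(2)] X_part Z_part
    by (simp add: X_part Z_part Z_eq[OF p] cv_def)
  then show ?thesis
    unfolding vec22_eq_iff by (simp only: Z1 Z2 Z3 \<alpha>) (simp add: z_def algebra_simps)
qed

subsection \<open>The five conditions\<close>

text \<open>The spaces in the first part are lines, on which every two-form vanishes.\<close>

lemma KK1_holds: KK1
  unfolding KK1_def
proof (intro ballI conjI)
  fix p X Y assume p: "p \<in> M"
  show "cbilin (F p) X Y = 0" if "X \<in> T12 p" "Y \<in> T12 p"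
    using that by (simp add: p cbilin_F T12_eq omega_form_def)
  show "cbilin (F p) X Y = 0" if "X \<in> T1b2 p" "Y \<in> T1b2 p"
    using that by (simp add: p cbilin_F T1b2_eq omega_form_def)
  show "cbilin (F p) X Y *s cv (- Dt 1) \<in> E1 p"
    by (simp add: p E1_eq)
qed

lemma smooth_derivative_z:
  assumes "open U" "U \<subseteq> M" "smooth_on U X"
  shows "smooth_on U (\<lambda>p. frechet_derivative X (at p) (z p))"
proof -
  have smooth: "smooth_on U \<rho>" "smooth_on U s"
    using basic_H assms(2) by (auto simp: basic_def intro: smooth_on_subset)
  have "smooth_on U (\<lambda>p. (- c * \<rho> p * s p) *\<^sub>R frechet_derivative X (at p) (axis (Inl 1) 1)
      + (- c * \<rho> p) *\<^sub>R frechet_derivative X (at p) (axis (Inl 2) 1))"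
    by (intro smooth_on_add smooth_on_scaleR smooth_on_mult smooth_on_const smooth assms(1)
        smooth_on_frechet_derivative assms(3))
  then show ?thesis
  proof (rule smooth_on_cong[OF assms(1)])
    fix p assume "p \<in> U"
    then show "(- c * \<rho> p * s p) *\<^sub>R frechet_derivative X (at p) (axis (Inl 1) 1)
        + (- c * \<rho> p) *\<^sub>R frechet_derivative X (at p) (axis (Inl 2) 1)
        = frechet_derivative X (at p) (z p)"
      unfolding frechet_derivative_expand[OF smooth_on_differentiable[OF assms(3) \<open>p \<in> U\<close>], of "z p"]
      by (simp add: sum_22 z_def)
  qed
qed

text \<open>The lines \<open>T12\<close> and \<open>T1b2\<close> are cut out by linear relations with basic coefficients. Such
  relations survive differentiation along \<open>Z\<close>.\<close>

lemma derivative_z_section: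
  fixes X :: "real ^ (2 + 2) \<Rightarrow> complex ^ (2 + 2)"
  assumes U: "open U" "U \<subseteq> M" and p: "p \<in> U" and X: "smooth_on U X" and \<psi>: "basic \<psi>"
    and rel: "\<And>q. q \<in> U \<Longrightarrow> X q $ k = w * of_real (\<psi> q) * X q $ j"
  shows "frechet_derivative X (at p) (z p) $ k
    = w * of_real (\<psi> p) * frechet_derivative X (at p) (z p) $ j"
proof -
  have pM: "p \<in> M" using U p by auto
  note dX = smooth_on_differentiable[OF X p]
  have d\<psi>: "(\<lambda>q. complex_of_real (\<psi> q)) differentiable (at p)"
    by (rule differentiable_complex_of_real[OF basic_differentiable[OF \<psi> pM]])
  have "((\<lambda>q. w * (of_real (\<psi> q) * X q $ j)) has_derivative (\<lambda>v.
      w * (of_real (\<psi> p) * frechet_derivative X (at p) v $ j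
        + of_real (frechet_derivative \<psi> (at p) v) * X p $ j))) (at p)"
    by (intro has_derivative_mult_right has_derivative_mult has_derivative_complex_of_real
        has_frechet_derivative[OF basic_differentiable[OF \<psi> pM]]
        bounded_linear.has_derivative[OF bounded_linear_vec_nth has_frechet_derivative[OF dX]])
  from frechet_derivative_eqI[OF this] show ?thesis
    using frechet_derivative_cong_open[OF U(1) p, of "\<lambda>q. X q $ k" "\<lambda>q. w * (of_real (\<psi> q) * X q $ j)"]
      rel basic_derivative_vertical[OF \<psi> pM, of "z p"]
    by (simp add: mult.assoc z_def flip: differentiable_nth(2)[OF dX])
qed

lemma basic_add_const: "basic \<psi> \<Longrightarrow> basic (\<lambda>p. \<psi> p + d)"
proof -
  assume \<psi>: "basic \<psi>"
  have "pd k (\<lambda>p. \<psi> p + d) p = pd k \<psi> p" if "p \<in> M" for k p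
    using frechet_derivative_eqI[OF has_derivative_add[OF
          has_frechet_derivative[OF basic_differentiable[OF \<psi> that]] has_derivative_const[of d]]]
    by (simp add: pd_def)
  then show ?thesis
    using \<psi> by (auto simp: basic_def intro!: smooth_on_add[OF open_M] smooth_on_const)
qed

text \<open>The coefficient of \<open>X\<^sub>0 = - \<partial>/\<partial>t\<^sup>1\<close> equals that of \<open>\<partial>/\<partial>t\<^sup>1\<close> in \<open>DZ X\<close>, because
  \<open>\<partial>s/\<partial>\<mu>\<^sup>2 = - \<lambda>\<^sub>0 (f\<^sup>2 + 1) / (a (f\<^sup>2 - 1))\<close>. Only the derivative of \<open>X\<close> along \<open>Z\<close> is left.\<close>

lemma KK2_holds: KK2
  unfolding KK2_def
proof (intro allI impI conjI ballI)
  fix U X assume "open U \<and> U \<subseteq> M"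
  then have U: "open U" "U \<subseteq> M" by auto
  have scalar: "(f p)\<^sup>2 * (lambda0 * (- (c * \<rho> p) * (1 + 1 / (f p)\<^sup>2))) / (a p * ((f p)\<^sup>2 - 1)) = c * \<rho> p * s2 p"
    if "p \<in> M" for p
  proof -
    have "(f p)\<^sup>2 * (1 + 1 / (f p)\<^sup>2) = (f p)\<^sup>2 + 1"
      using f_nonzero[OF that] by (simp add: distrib_left)
    moreover have "x * (l * (- K * y)) / d = K * (- l * (x * y) / d)" for x l K y d :: real by simp
    ultimately show ?thesis by (simp only: s2_eq[OF that])
  qed
  \<comment> \<open>\<open>\<sigma> = 1\<close> is the half with \<open>v\<^sub>f\<close> on \<open>T12\<close>, \<open>\<sigma> = - 1\<close> the one with \<open>v\<^sub>i\<^sub>f\<close> on \<open>T1b2\<close>\<close>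
  {
    fix \<sigma> :: real and v :: "real ^ (2 + 2) \<Rightarrow> complex ^ (2 + 2)" and T
    assume \<sigma>: "\<sigma> = 1 \<or> \<sigma> = - 1"
      and T: "\<And>p. p \<in> M \<Longrightarrow> T p = {X. X $ Inr 1 = 0 \<and> X $ Inl 1 = - \<i> * of_real (H12 p + \<sigma> * c) * X $ Inr 2
        \<and> X $ Inl 2 = - \<i> * of_real (H22 p) * X $ Inr 2}"
      and v: "\<And>p. p \<in> M \<Longrightarrow> v p = tm_vec (- 1 + of_real (\<sigma> * c * \<rho> p * s p / (f p)\<^sup>2)) (of_real (\<sigma> * c * \<rho> p / (f p)\<^sup>2))
          (- \<i> * of_real (\<rho> p)) (\<i> * of_real (\<rho> p * s p))"
      and X: "X \<in> sections U T"
    let ?R = "\<lambda>p. DZ X p + of_real \<sigma> * (of_real ((f p)\<^sup>2) * cbilin (F p) (v p) (X p)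
      / of_real (a p * ((f p)\<^sup>2 - 1))) *s cv (- Dt 1)"
    have smooth: "smooth_on U X" and XT: "\<And>p. p \<in> U \<Longrightarrow> X p \<in> T p" using X by (auto simp: sections_def)
    have rel: "X p $ Inr 1 = 0" "X p $ Inl 1 = - \<i> * of_real (H12 p + \<sigma> * c) * X p $ Inr 2"
      "X p $ Inl 2 = - \<i> * of_real (H22 p) * X p $ Inr 2" if "p \<in> U" for p
      using XT[OF that] T[of p] U(2) that by auto
    have R: "?R p = frechet_derivative X (at p) (z p)" if "p \<in> U" for p
    proof -
      have p: "p \<in> M" using that U by auto
      have "omega_form (v p) (X p) = of_real \<sigma> * of_real (- (c * \<rho> p) * (1 + 1 / (f p)\<^sup>2)) * X p $ Inr 2"
      proof -
        have "H22 p * s p = H12 p" using H_pos(1)[OF p] by (simp add: s_def)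
        then have "complex_of_real (H22 p) * of_real (s p) = of_real (H12 p)" by (metis of_real_mult)
        then show ?thesis
          by (simp add: omega_form_def v[OF p] rel[OF that] algebra_simps)
      qed
      then have "of_real \<sigma> * (of_real ((f p)\<^sup>2) * cbilin (F p) (v p) (X p) / of_real (a p * ((f p)\<^sup>2 - 1)))
        = of_real (\<sigma> * \<sigma>) * of_real ((f p)\<^sup>2 * (lambda0 * (- (c * \<rho> p) * (1 + 1 / (f p)\<^sup>2))) / (a p * ((f p)\<^sup>2 - 1))) * X p $ Inr 2"
        by (simp add: cbilin_F[OF p])
      also have "\<dots> = of_real (c * \<rho> p * s2 p) * X p $ Inr 2"
        unfolding scalar[OF p] using \<sigma> by auto
      finally show ?thesis
        unfolding DZ_eq[OF p smooth_on_differentiable[OF smooth that] rel(1)[OF that]]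
        by (simp add: vec22_eq_iff cv_def Dt_def axis_def)
    qed
    have "?R \<in> sections U T"
      unfolding sections_def mem_Collect_eq
    proof (intro conjI ballI)
      show "smooth_on U ?R"
        by (rule smooth_on_cong[OF U(1) smooth_derivative_z[OF U smooth]]) (simp only: R)
      fix p assume p: "p \<in> U"
      have "frechet_derivative X (at p) (z p) $ Inr 1 = 0 * of_real (H22 p) * frechet_derivative X (at p) (z p) $ Inr 2"
        by (rule derivative_z_section[OF U p smooth basic_H(2)]) (simp add: rel)
      moreover note derivative_z_section[OF U p smooth basic_add_const[OF basic_H(1)] rel(2)]
        derivative_z_section[OF U p smooth basic_H(2) rel(3)]
      ultimately show "?R p \<in> T p"
        unfolding R[OF p] using T[of p] U(2) p by auto
    qed
  } note main = this
  show "(\<lambda>p. DZ X p + (of_real ((f p)\<^sup>2) * cbilin (F p) (fst (vf p)) (X p)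
      / of_real (a p * ((f p)\<^sup>2 - 1))) *s cv (- Dt 1)) \<in> sections U T12" if "X \<in> sections U T12"
    using main[of 1 T12 "\<lambda>p. fst (vf p)"] that by (simp add: T12_eq fst_vf)
  show "(\<lambda>p. DZ X p - (of_real ((f p)\<^sup>2) * cbilin (F p) (fst (vif p)) (X p)
      / of_real (a p * ((f p)\<^sup>2 - 1))) *s cv (- Dt 1)) \<in> sections U T1b2" if "X \<in> sections U T1b2"
  proof -
    have "(\<lambda>p. DZ X p + of_real (- 1) * (of_real ((f p)\<^sup>2) * cbilin (F p) (fst (vif p)) (X p)
        / of_real (a p * ((f p)\<^sup>2 - 1))) *s cv (- Dt 1)) \<in> sections U T1b2"
      by (rule main[of "- 1" T1b2 "\<lambda>p. fst (vif p)"]) (use that in \<open>simp_all add: T1b2_eq fst_vif\<close>)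
    moreover have "x + of_real (- 1) * y *s w = x - y *s w" for x w :: "complex ^ (2 + 2)" and y
      by (simp add: vec_eq_iff)
    ultimately show ?thesis by (simp only:)
  qed
qed

text \<open>\<open>a f\<^sup>2 h\<^sup>2 = k\<^sub>0 f\<^sup>2\<close> is a function of \<open>\<mu>\<^sup>1\<close>, and \<open>d\<mu>\<^sup>1 = \<J>\<^sub>2X\<^sub>0\<close> lies in \<open>\<S>\<close>.\<close>

lemma KK3_holds: KK3
  unfolding KK3_def
proof (intro ballI)
  fix p X assume p: "p \<in> M" and X: "X \<in> fst ` orth (S p)"
  have X1: "X $ Inr 1 = 0"
    using X toric_fibre.Sperp_iff[OF fibre[OF p]] by (auto simp: orth_S_eq[OF p])
  have *: "k0 * (f q)\<^sup>2 = a q * (f q)\<^sup>2 * (h q)\<^sup>2" if "q \<in> M" for q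
    using ah2[OF that] by (simp add: algebra_simps)
  have d: "(\<lambda>q. k0 * (f q)\<^sup>2) differentiable (at p)"
    using f2_differentiable[OF p] by (intro differentiable_mult) auto
  have "frechet_derivative (\<lambda>q. k0 * (f q)\<^sup>2) (at p) X = 0"
    by (rule f2_derivative[OF p X1 d]) simp
  then show "frechet_derivative (\<lambda>q. a q * (f q)\<^sup>2 * (h q)\<^sup>2) (at p) X = 0"
    using frechet_derivative_cong_open[OF open_M p *] by simp
qed

text \<open>As \<open>(2 a / h) dh = \<lambda>\<^sub>0 d\<mu>\<^sup>1\<close> and \<open>F = \<lambda>\<^sub>0 \<omega>\<close>, the first part is \<open>\<epsilon>\<^sub>1 \<and> \<omega> = 0\<close> contracted with \<open>X\<^sub>0\<close>.
  In the second part \<open>dh\<close> vanishes on all three spaces.\<close>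

lemma KK4_holds: KK4
  unfolding KK4_def
proof (intro ballI conjI)
  fix p and X Y W :: "complex ^ (2 + 2)"
  assume p: "p \<in> M"
  have e: "eps1 p = (\<lambda>X. ev (toric_fibre.eps1_form (H11 p) (H12 p) (H22 p) c X))"
    using toric_fibre.eps1_eq[OF fibre[OF p], of "eps1 p"] eps1[OF p] by (intro ext) (simp add: L1_def)
  have scale: "wedge12 \<theta> (\<lambda>X Y. l * B X Y) X Y W = l * wedge12 \<theta> B X Y W"
    "wedge21 B (\<lambda>X. m * \<theta> X) X Y W = m * wedge21 B \<theta> X Y W" for \<theta> B l m
    by (simp_all add: wedge12_def wedge21_def algebra_simps)
  have F: "cbilin (F p) = (\<lambda>X Y. of_real lambda0 * omega_form X Y)"
    and dh: "ev (dh p) = (\<lambda>X. of_real (lambda0 * h p / (2 * a p)) * X $ Inr 1)"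
    by (simp_all add: fun_eq_iff cbilin_F[OF p] ev_dh[OF p])
  have "2 * a p / h p * (lambda0 * h p / (2 * a p)) = lambda0"
    using a_nonzero[OF p] h_nonzero[OF p] by simp
  then have "of_real (2 * a p / h p) * of_real (lambda0 * h p / (2 * a p)) = complex_of_real lambda0"
    by (metis of_real_mult)
  then have product: "of_real lambda0 * - w
      = - of_real (2 * a p / h p) * (of_real (lambda0 * h p / (2 * a p)) * w)" for w :: complex
    by (simp only: mult_minus_left mult_minus_right mult.assoc[symmetric])
  show "wedge12 (eps1 p (cv (- Dt 1))) (cbilin (F p)) X Y W
      = - of_real (2 * a p / h p) * wedge21 (eps1 p) (ev (dh p)) X Y W"
    unfolding F dh scale e toric_fibre.eps1_wedge_omega[OF fibre[OF p]]
    by (rule product)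
  show "wedge21 (eps2 p) (ev (dh p)) X Y W = 0" if "X \<in> T12 p" "Y \<in> Tb12 p" "W \<in> T2 p"
    using that T2_imp(1)[OF p that(3)] Tb12_imp[OF p that(2)]
    by (simp add: wedge21_def dh T12_eq[OF p])
qed

lemma bounded_bilinear_omega: "bounded_bilinear (omega_form :: complex ^ (2 + 2) \<Rightarrow> _)"
proof -
  have "bilinear (omega_form :: complex ^ (2 + 2) \<Rightarrow> _)"
    unfolding bilinear_def
    by (intro conjI allI linearI) (simp_all add: omega_form_def algebra_simps)
  then show ?thesis by (simp add: bilinear_conv_bounded_bilinear)
qed

text \<open>\<open>\<epsilon>\<^sub>2 = - i \<omega>\<close> has constant coefficients, so differentiation along \<open>Z\<close> contributes nothing. The
  extra term of \<open>DZ\<close> is a multiple of \<open>\<partial>/\<partial>t\<^sup>1\<close>, which \<open>\<omega>\<close> only pairs with \<open>\<partial>/\<partial>\<mu>\<^sup>1\<close>.\<close>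

lemma Deps2_eq_0:
  assumes U: "open U" "U \<subseteq> M" and X: "X \<in> sections U T2" and Y: "Y \<in> sections U T2" and p: "p \<in> U"
  shows "Deps2 X Y p = 0"
proof -
  have pM: "p \<in> M" using U p by auto
  have dX: "X differentiable (at p)" and dY: "Y differentiable (at p)"
    and X1: "X p $ Inr 1 = 0" and Y1: "Y p $ Inr 1 = 0"
    using X Y p T2_imp(1)[OF pM] by (auto simp: sections_def intro: smooth_on_differentiable)
  have D: "((\<lambda>q. - \<i> * omega_form (X q) (Y q)) has_derivative (\<lambda>v. - \<i> *
      (omega_form (X p) (frechet_derivative Y (at p) v) + omega_form (frechet_derivative X (at p) v) (Y p)))) (at p)"
    by (intro has_derivative_mult_right bounded_bilinear.FDERIV[OF bounded_bilinear_omega]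
        has_frechet_derivative dX dY)
  have "cdir (Z p) (\<lambda>q. eps2 q (X q) (Y q)) p = cdir (Z p) (\<lambda>q. - \<i> * omega_form (X q) (Y q)) p"
    using eps2_eq by (intro cdir_cong_open[OF open_M pM]) auto
  also have "\<dots> = - \<i> * (omega_form (X p) (frechet_derivative Y (at p) (z p))
      + omega_form (frechet_derivative X (at p) (z p)) (Y p))"
  proof -
    have "(\<lambda>q. - \<i> * omega_form (X q) (Y q)) differentiable (at p)"
      using D by (auto simp: differentiable_def)
    from cdir_cv[OF this, of "z p"] show ?thesis
      by (simp only: Z_eq[OF pM] frechet_derivative_eqI[OF D])
  qed
  finally show ?thesis
    unfolding Deps2_def DZ_eq[OF pM dX X1] DZ_eq[OF pM dY Y1] eps2_eq[OF pM]
    by (simp add: omega_form_def X1 Y1 algebra_simps)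
qed

text \<open>On vectors with \<open>d\<mu>\<^sup>1 = 0\<close> each term is a multiple of \<open>\<omega>\<close>: the first one through
  \<open>ds \<and> dt\<^sup>2\<close>, the right-hand side through the derivative of \<open>h\<close> along \<open>v\<^sub>f\<close>. The coefficients agree
  by the formula for \<open>\<partial>s/\<partial>\<mu>\<^sup>2\<close>; both sides are \<open>- 2 \<lambda>\<^sub>0 / a\<close> times \<open>\<omega>(X, Y)\<close>.\<close>

lemma KK5_holds: KK5
  unfolding KK5_def
proof (intro allI impI ballI)
  fix U X Y p assume "open U \<and> U \<subseteq> M" and XY: "X \<in> sections U T2" "Y \<in> sections U T2" and pU: "p \<in> U"
  then have U: "open U" "U \<subseteq> M" and p: "p \<in> M" by auto
  have X1: "X p $ Inr 1 = 0" and Y1: "Y p $ Inr 1 = 0"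
    using XY pU T2_imp(1)[OF p] by (auto simp: sections_def)
  \<comment> \<open>\<open>G(X\<^sub>0, X\<^sub>0) = \<rho> / 2\<close> cancels the factor \<open>\<rho>\<close> of the cotangent part of \<open>\<J>\<^sub>3X\<^sub>0\<close>\<close>
  define \<psi> where "\<psi> q = 2 * (1 - (f q)\<^sup>2) / (f q)\<^sup>2" for q
  have d\<psi>: "\<psi> differentiable (at p)"
    unfolding \<psi>_def[abs_def] using smooth_on_differentiable[OF smooth_f p] f_nonzero[OF p]
    by (intro differentiable_divide differentiable_mult differentiable_diff) auto
  note ds = basic_differentiable[OF basic_H(3) p]
  have "frechet_derivative \<psi> (at p) v = 0" if "v $ Inr 1 = 0" for v
    by (rule f2_derivative[OF p that d\<psi>]) (simp only: \<psi>_def)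
  then have \<psi>0: "pd (Inl i) \<psi> p = 0" "pd (Inr 2) \<psi> p = 0" for i by (simp_all add: pd_def axis_def)
  have D: "((\<lambda>q. - (\<psi> q * s q)) has_derivative
      (\<lambda>v. - (\<psi> p * frechet_derivative s (at p) v + frechet_derivative \<psi> (at p) v * s p))) (at p)"
    by (intro has_derivative_minus has_derivative_mult has_frechet_derivative d\<psi> ds)
  then have d\<psi>s: "(\<lambda>q. - (\<psi> q * s q)) differentiable (at p)" by (auto simp: differentiable_def)
  have \<psi>s0: "pd (Inl i) (\<lambda>q. - (\<psi> q * s q)) p = 0" "pd (Inr 2) (\<lambda>q. - (\<psi> q * s q)) p = - \<psi> p * s2 p" for i
    using frechet_derivative_eqI[OF D] \<psi>0 basic_H(3) p by (simp_all add: pd_def basic_def)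
  have "((1 - (f q)\<^sup>2) / ((f q)\<^sup>2 * GX0 q)) *\<^sub>R snd (J3 q (gX0 q))
      = \<psi> q *\<^sub>R dt 1 + (- (\<psi> q * s q)) *\<^sub>R dt 2" if "q \<in> M" for q
    using \<rho>_pos[OF that] f_nonzero[OF that]
    by (simp add: J3_gX0[OF that] GX0_eq[OF that] vec22_eq_iff dt_def axis_def \<psi>_def)
  then have "extd1 (\<lambda>q. ((1 - (f q)\<^sup>2) / ((f q)\<^sup>2 * GX0 q)) *\<^sub>R snd (J3 q (gX0 q))) p
      = extd1 (\<lambda>q. \<psi> q *\<^sub>R dt 1 + (- (\<psi> q * s q)) *\<^sub>R dt 2) p"
    by (rule extd1_cong_open[OF open_M p])
  also have "\<dots> = (\<lambda>u v. wedge (diff0 \<psi> p) (dt 1) u v + wedge (diff0 (\<lambda>q. - (\<psi> q * s q)) p) (dt 2) u v)"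
  proof -
    have d: "(\<lambda>q. ev (\<phi> q *\<^sub>R \<eta>) v) differentiable (at p)" if "\<phi> differentiable (at p)"
      for \<phi> :: "real ^ (2 + 2) \<Rightarrow> real" and \<eta> v :: "real ^ (2 + 2)"
      unfolding ev_scaleR_left using that by (intro differentiable_mult) auto
    show ?thesis
      unfolding extd1_add[OF d[OF d\<psi>] d[OF d\<psi>s]] extd1_scaleR[OF d\<psi>] extd1_scaleR[OF d\<psi>s] ..
  qed
  finally have t1: "cbilin (extd1 (\<lambda>q. ((1 - (f q)\<^sup>2) / ((f q)\<^sup>2 * GX0 q)) *\<^sub>R snd (J3 q (gX0 q))) p) (X p) (Y p)
      = - of_real (\<psi> p * s2 p) * omega_form (X p) (Y p)"
    by (simp add: cbilin_add cbilin_wedge)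
      (simp add: wedge_def ev_def sum_22 cv_def diff0_def \<psi>0 \<psi>s0 X1 Y1 dt_def axis_def omega_form_def algebra_simps)
  have rhs: "ev (dh p) (fst (vf p)) * eps2 p (X p) (Y p) + wedge (snd (vf p)) (dh p) (X p) (Y p)
      = - of_real (\<rho> p * (lambda0 * h p / (2 * a p))) * omega_form (X p) (Y p)"
  proof -
    have "of_real x * (- \<i> * of_real y) * (- \<i> * w) = - of_real (y * x) * w" for x y w
      by (simp add: complex_eq_iff algebra_simps)
    moreover have "wedge (snd (vf p)) (dh p) (X p) (Y p) = 0"
      by (simp add: wedge_def ev_dh[OF p] X1 Y1)
    ultimately show ?thesis
      by (simp only: ev_dh[OF p] fst_vf[OF p] eps2_eq[OF p] tm_vec_nth add_0_right)
  qed
  have scalar: "- (\<psi> p * s2 p) + 2 / (a p * (f p)\<^sup>2) * lambda0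
      = 2 / (h p * GX0 p) * - (\<rho> p * (lambda0 * h p / (2 * a p)))"
  proof -
    have "\<psi> p * s2 p = 2 * lambda0 * ((f p)\<^sup>2 + 1) / (a p * (f p)\<^sup>2)"
      using f2_neq_1[OF p] a_nonzero[OF p] f_nonzero[OF p]
      by (simp add: \<psi>_def s2_eq[OF p] divide_simps) (simp add: algebra_simps)
    then show ?thesis
      using \<rho>_pos[OF p] h_nonzero[OF p] a_nonzero[OF p] f_nonzero[OF p]
      by (simp add: GX0_eq[OF p] field_simps)
  qed
  have "of_real (- (\<psi> p * s2 p) + 2 / (a p * (f p)\<^sup>2) * lambda0) * omega_form (X p) (Y p)
    = of_real (2 / (h p * GX0 p) * - (\<rho> p * (lambda0 * h p / (2 * a p)))) * omega_form (X p) (Y p)"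
    by (simp only: scalar)
  then show "cbilin (extd1 (\<lambda>q. ((1 - (f q)\<^sup>2) / ((f q)\<^sup>2 * GX0 q)) *\<^sub>R snd (J3 q (gX0 q))) p) (X p) (Y p)
      + of_real (((f p)\<^sup>2 - 1) / ((f p)\<^sup>2 * GX0 p)) * Deps2 X Y p
      + of_real (2 / (a p * (f p)\<^sup>2)) * cbilin (F p) (X p) (Y p)
      = of_real (2 / (h p * GX0 p)) * (ev (dh p) (fst (vf p)) * eps2 p (X p) (Y p)
          + wedge (snd (vf p)) (dh p) (X p) (Y p))"
    unfolding t1 rhs Deps2_eq_0[OF U XY pU] cbilin_F[OF p]
    by (simp only: of_real_add of_real_mult of_real_minus distrib_right mult_zero_right add_0_right
        mult.assoc mult_minus_left mult_minus_right)
qed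

end

section \<open>The twist data of the corollary\<close>

theorem corollary51:
  fixes M :: "(real ^ (2 + 2)) set"
    and \<tau> :: "real ^ 2 \<Rightarrow> real"
    and C :: "real ^ 2 ^ 2"
    and GE J :: "real ^ (2 + 2) \<Rightarrow> (2 + 2) gtm \<Rightarrow> (2 + 2) gtm"
    and eps1 eps2 :: "real ^ (2 + 2) \<Rightarrow> complex ^ (2 + 2) \<Rightarrow> complex ^ (2 + 2) \<Rightarrow> complex"
    and X0 :: "real ^ (2 + 2) \<Rightarrow> real ^ (2 + 2)"
    and k0 k1 lambda0 :: real
    and a f h :: "real ^ (2 + 2) \<Rightarrow> real"
    and F :: "real ^ (2 + 2) \<Rightarrow> real ^ (2 + 2) \<Rightarrow> real ^ (2 + 2) \<Rightarrow> real"
  assumes "open M" and "connected M"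
    and "smooth_on (mu ` M) \<tau>"
    and "\<forall>x\<in>mu ` M. \<forall>v. v \<noteq> 0 \<longrightarrow> (\<Sum>i\<in>UNIV. \<Sum>j\<in>UNIV. hess \<tau> x $ i $ j * v $ i * v $ j) > 0"
    and "\<forall>i j. C $ i $ j = - C $ j $ i"
    and "C $ 1 $ 2 \<noteq> 0"
    and "toric_structure M \<tau> C GE J"
    and "\<forall>p\<in>M. presents (eps1 p) (kk_data.L1 J p)"
    and "\<forall>p\<in>M. presents (eps2 p) (kk_data.L2 GE J p)"
    and "\<exists>c. \<forall>x\<in>mu ` M. pd 2 (Psi_ratio \<tau> C) x = c (x $ 1)"
    and "k0 \<noteq> 0" and "lambda0 \<noteq> 0"
    and "X0 = (\<lambda>p. - Dt 1)"
    and "a = (\<lambda>p. k0 * k1 - lambda0 * mu p $ 1)"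
    and "smooth_on M h"
    and "\<forall>p\<in>M. (h p)\<^sup>2 = - k0 / (lambda0 * mu p $ 1 - k0 * k1)"
    and "smooth_on M f"
    and "\<forall>p\<in>M. (f p)\<^sup>2 =
           ((mu p $ 1 - k0 * k1 / lambda0) * pd 2 (Psi_ratio \<tau> C) (mu p) + 1) /
           ((mu p $ 1 - k0 * k1 / lambda0) * pd 2 (Psi_ratio \<tau> C) (mu p) - 1)"
    and "F = (\<lambda>p. let c = 2 * a p * pd (Inr 1) h p / h p in
           (\<lambda>X Y. c * wedge (dmu 1) (dt 1) X Y
              + wedge ((Psi_ratio \<tau> C (mu p) * (lambda0 - c)) *\<^sub>R dmu 1 + lambda0 *\<^sub>R dmu 2) (dt 2) X Y))"
    and "\<forall>p\<in>M. a p \<noteq> 0"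
    and "\<forall>p\<in>M. - k0 / (lambda0 * mu p $ 1 - k0 * k1) > 0"
    and "\<forall>p\<in>M.
           ((mu p $ 1 - k0 * k1 / lambda0) * pd 2 (Psi_ratio \<tau> C) (mu p) + 1) /
           ((mu p $ 1 - k0 * k1 / lambda0) * pd 2 (Psi_ratio \<tau> C) (mu p) - 1) > 0"
  shows "closed_two_form M F \<and>
     flow_invariant M X0 F \<and>
     (\<forall>p\<in>M. \<forall>v. frechet_derivative a (at p) v = - F p (X0 p) v) \<and>
     kk_data.KK1 M GE J X0 F \<and>
     kk_data.KK2 M GE J X0 F a f \<and>
     kk_data.KK3 M GE J X0 a f h \<and>
     kk_data.KK4 M GE J X0 F a h eps1 eps2 \<and>
     kk_data.KK5 M GE J X0 F a f h eps2"
proof -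
  have open_M: "open M" and smooth_h: "smooth_on M h" and smooth_f: "smooth_on M f"
    and k0: "k0 \<noteq> 0" and lambda0: "lambda0 \<noteq> 0" by fact+
  have X0: "X0 = (\<lambda>p. - Dt 1)" and a: "a = (\<lambda>p. k0 * k1 - lambda0 * mu p $ 1)" by fact+
  have a_nonzero: "a p \<noteq> 0" if "p \<in> M" for p using assms(20) that by blast
  have h2: "(h p)\<^sup>2 = k0 / a p" if "p \<in> M" for p
  proof -
    have "(h p)\<^sup>2 = - k0 / - a p" using assms(16) that by (simp add: a)
    then show ?thesis by simp
  qed
  have ah2: "a p * (h p)\<^sup>2 = k0" and h_nonzero: "h p \<noteq> 0" if "p \<in> M" for p
    using h2[OF that] a_nonzero[OF that] k0 by auto
  have da: "(a has_derivative (\<lambda>v. - lambda0 * v $ Inr 1)) (at p)" for p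
    unfolding a mu_def by (auto intro!: derivative_eq_intros bounded_linear.has_derivative[OF bounded_linear_vec_nth])
  have dh: "frechet_derivative h (at p) v = lambda0 * h p / (2 * a p) * v $ Inr 1" if p: "p \<in> M" for p v
  proof -
    have "((\<lambda>q. a q * (h q)\<^sup>2) has_derivative (\<lambda>v. a p * (2 * h p * frechet_derivative h (at p) v)
        + - lambda0 * v $ Inr 1 * (h p)\<^sup>2)) (at p)"
      using has_frechet_derivative[OF smooth_on_differentiable[OF smooth_h p]]
      by (auto intro!: has_derivative_mult da derivative_eq_intros simp: algebra_simps)
    from frechet_derivative_eqI[OF this, of v]
    have "a p * (2 * h p * frechet_derivative h (at p) v) - lambda0 * v $ Inr 1 * (h p)\<^sup>2 = 0"
      using frechet_derivative_cong_open[OF open_M p ah2] by (simp add: frechet_derivative_const)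
    then have "h p * (2 * a p * frechet_derivative h (at p) v - lambda0 * v $ Inr 1 * h p) = 0"
      by (simp add: algebra_simps power2_eq_square)
    then show ?thesis using h_nonzero[OF p] a_nonzero[OF p] by (simp add: field_simps)
  qed
  \<comment> \<open>\<open>2 a h' / h = \<lambda>\<^sub>0\<close>, so the \<open>d\<mu>\<^sup>1 \<and> dt\<^sup>2\<close> term of \<open>F\<close> disappears\<close>
  have F: "F p = (\<lambda>X Y. lambda0 * omega_form X Y)" if p: "p \<in> M" for p
  proof -
    have c: "2 * a p * pd (Inr 1) h p / h p = lambda0"
      using dh[OF p, of "axis (Inr 1) 1"] h_nonzero[OF p] a_nonzero[OF p]
      by (simp add: pd_def axis_def)
    show ?thesis
      unfolding assms(19) Let_def c
      by (intro ext) (simp add: omega_form_def wedge_def ev_def sum_22 dmu_def dt_def axis_def algebra_simps)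
  qed
  \<comment> \<open>\<open>f\<^sup>2 = (y + 1) / (y - 1)\<close>, equivalently \<open>y = (f\<^sup>2 + 1) / (f\<^sup>2 - 1)\<close>\<close>
  define y where "y p = (mu p $ 1 - k0 * k1 / lambda0) * pd 2 (Psi_ratio \<tau> C) (mu p)" for p
  have f2: "(f p)\<^sup>2 = (y p + 1) / (y p - 1)" and f2_pos: "(y p + 1) / (y p - 1) > 0" if "p \<in> M" for p
    using assms(18,22) that by (simp_all add: y_def)
  have y1: "y p - 1 \<noteq> 0" if "p \<in> M" for p using f2_pos[OF that] by auto
  have f2_shift: "(f p)\<^sup>2 - 1 = 2 / (y p - 1)" "(f p)\<^sup>2 + 1 = 2 * y p / (y p - 1)" if "p \<in> M" for p
    using y1[OF that] by (simp_all add: f2[OF that] field_simps)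
  have ay: "a p * pd 2 (Psi_ratio \<tau> C) (mu p) = - lambda0 * y p" for p
    using lambda0 by (simp add: a y_def field_simps)
  obtain \<kappa> where \<kappa>: "\<And>x. x \<in> mu ` M \<Longrightarrow> pd 2 (Psi_ratio \<tau> C) x = \<kappa> (x $ 1)"
    using assms(10) by blast
  interpret toric_kk M \<tau> C GE J F a f h eps1 eps2 k0 lambda0
  proof unfold_locales
    show "\<exists>\<Phi>. \<forall>p\<in>M. (f p)\<^sup>2 = \<Phi> (p $ Inr 1)"
    proof (intro exI ballI)
      fix p assume "p \<in> M"
      then show "(f p)\<^sup>2 = (\<lambda>m. ((m - k0 * k1 / lambda0) * \<kappa> m + 1) / ((m - k0 * k1 / lambda0) * \<kappa> m - 1)) (p $ Inr 1)"
        by (simp add: f2 y_def \<kappa> mu_def)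
    qed
    fix p assume p: "p \<in> M"
    show "(f p)\<^sup>2 \<noteq> 1" using f2_shift(1)[OF p] y1[OF p] by auto
    show "f p \<noteq> 0" using f2_pos[OF p] f2[OF p] by auto
    show "a p * ((f p)\<^sup>2 - 1) * pd 2 (Psi_ratio \<tau> C) (mu p) = - lambda0 * ((f p)\<^sup>2 + 1)"
    proof -
      have "a p * (2 / (y p - 1)) * pd 2 (Psi_ratio \<tau> C) (mu p)
          = (a p * pd 2 (Psi_ratio \<tau> C) (mu p)) * 2 / (y p - 1)" by simp
      then show ?thesis unfolding f2_shift[OF p] ay by simp
    qed
    show "presents (eps1 p) (kk_data.L1 J p)" "presents (eps2 p) (kk_data.L2 GE J p)"
      using assms(8,9) p by auto
  qed (use assms(4,5) assms(1,3,6,7) smooth_f smooth_h F dh ah2 h_nonzero a_nonzero in \<open>blast+\<close>)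
  have "frechet_derivative a (at p) v = - F p (- Dt 1) v" if "p \<in> M" for p v
    using frechet_derivative_eqI[OF da] by (simp add: F[OF that] omega_form_def Dt_def axis_def)
  moreover have "closed_two_form M F" "flow_invariant M X0 F"
    unfolding X0 by (rule closed_two_form_constant[OF open_M] flow_invariant_constant; simp add: F)+
  ultimately show ?thesis
    unfolding X0 using KK1_holds KK2_holds KK3_holds KK4_holds KK5_holds by blast
qed

end
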